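(* Let $(\mathcal{H},\langle\cdot,\cdot\rangle)$ be a separable complex Hilbert space, let $E$ be $\mathcal{H}$ regarded as a real symplectic vector space with $\sigma=\operatorname{Im}\langle\cdot,\cdot\rangle$, and let $h\in[0,+\infty)$. Let $Q_h:\mathcal{W}(E,0)\to\mathcal{W}(E,h\sigma)$ be the abstract quantization map, i.e. the unique continuous linear map with $Q_h(W^0(f))=e^{-\frac h4\|f\|^2}W^h(f)$ for all $f\in E$. Then $Q_h$ is injective on the full $C^*$-algebra $\mathcal{W}(E,0)$, but it is not surjective.
   Context: $\|f\|=\langle f,f\rangle^{1/2}$. For $h\ge0$, $\Delta(E,h\sigma)$ is the unital $*$-algebra with linear basis $\{W^h(f):f\in E\}$ and relations $W^h(f)W^h(g)=e^{-\frac i2h\sigma(f,g)}W^h(f+g)$, $W^h(f)^*=W^h(-f)$, $W^h(0)=I$. The norm $\|A\|_h=\sup_\omega\omega(A^*A)^{1/2}$ (supremum over all normalized positive linear functionals $\omega$ on $\Delta(E,h\sigma)$) is a $C^*$-norm, and the Weyl $C^*$-algebra $\mathcal{W}(E,h\sigma)$ is the completion of $\Delta(E,h\sigma)$ in $\|\cdot\|_h$. The linear map defined on $\Delta(E,0)$ by $W^0(f)\mapsto e^{-\frac h4\|f\|^2}W^h(f)$ is norm-contractive from $\|\cdot\|_0$ to $\|\cdot\|_h$ and so extends continuously to $\mathcal{W}(E,0)$.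
   Formalization: Non-surjectivity is stated only for h > 0 and H nonzero: for h = 0 the map Q_0 is the identity, and for H = {0} both algebras are the complex numbers, so Q_h is surjective there. Injectivity is stated for all h ≥ 0 and all H. *)

theory Defs
  imports "HOL-Analysis.Analysis" "HOL-Algebra.Module" "HOL-Library.Poly_Mapping"
begin

(* The norm of real_inner is sqrt (inner x x), so inner_eq_Re_cinner together with
   Hermitian symmetry says norm f = <f,f>^(1/2).  The real vector space structure
   (E, the space H regarded as a real vector space) is the one of real_inner.  The inner
   product is antilinear in the first argument. *)
class complex_hilbert_space = real_inner + complete_space +
  fixes scaleC :: "complex \<Rightarrow> 'a \<Rightarrow> 'a"
    and cinner :: "'a \<Rightarrow> 'a \<Rightarrow> complex"
  assumes scaleC_add_right: "scaleC c (x + y) = scaleC c x + scaleC c y"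
    and scaleC_add_left: "scaleC (c + d) x = scaleC c x + scaleC d x"
    and scaleC_scaleC: "scaleC c (scaleC d x) = scaleC (c * d) x"
    and scaleC_of_real: "scaleC (complex_of_real r) x = scaleR r x"
    and cinner_commute: "cinner x y = cnj (cinner y x)"
    and cinner_add_right: "cinner x (y + z) = cinner x y + cinner x z"
    and cinner_scaleC_right: "cinner x (scaleC c y) = c * cinner x y"
    and inner_eq_Re_cinner: "inner x y = Re (cinner x y)"

definition symp :: "'h::complex_hilbert_space \<Rightarrow> 'h \<Rightarrow> real" where
  "symp f g = Im (cinner f g)"


subsection \<open>The *-algebra \<open>\<Delta>(E, s)\<close>\<close>

text \<open>
  For a form \<open>s\<close> on \<open>E\<close> (below \<open>s = h \<sigma>\<close>) the underlying vector space of \<open>\<Delta>(E, s)\<close> is the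
  space of finitely supported functions \<open>E \<Rightarrow>\<^sub>0 complex\<close>, the basis element \<open>W(f)\<close> being the
  point mass at \<open>f\<close>. Only the product depends on \<open>s\<close>. The multiplication of the type
  \<open>E \<Rightarrow>\<^sub>0 complex\<close> itself (untwisted convolution) is not used.
\<close>

definition weyl_W :: "'e \<Rightarrow> ('e::real_vector \<Rightarrow>\<^sub>0 complex)" where
  "weyl_W f = Poly_Mapping.single f 1"

definition weyl_scale :: "complex \<Rightarrow> ('e::real_vector \<Rightarrow>\<^sub>0 complex) \<Rightarrow> ('e \<Rightarrow>\<^sub>0 complex)" where
  "weyl_scale c A = Poly_Mapping.map ((*) c) A"

definition weyl_mult ::
  "('e::real_vector \<Rightarrow> 'e \<Rightarrow> real) \<Rightarrow> ('e \<Rightarrow>\<^sub>0 complex) \<Rightarrow> ('e \<Rightarrow>\<^sub>0 complex) \<Rightarrow> ('e \<Rightarrow>\<^sub>0 complex)"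
  where
  "weyl_mult s A B =
     (\<Sum>f\<in>Poly_Mapping.keys A. \<Sum>g\<in>Poly_Mapping.keys B.
        Poly_Mapping.single (f + g)
          (Poly_Mapping.lookup A f * Poly_Mapping.lookup B g
             * exp (- (\<i> / 2) * complex_of_real (s f g))))"

definition weyl_star :: "('e::real_vector \<Rightarrow>\<^sub>0 complex) \<Rightarrow> ('e \<Rightarrow>\<^sub>0 complex)" where
  "weyl_star A =
     (\<Sum>f\<in>Poly_Mapping.keys A. Poly_Mapping.single (- f) (cnj (Poly_Mapping.lookup A f)))"

lemma weyl_scale_single:
  "weyl_scale c (Poly_Mapping.single f a) = Poly_Mapping.single f (c * a)"
  by (rule poly_mapping_eqI)
    (auto simp: weyl_scale_def Poly_Mapping.map.rep_eq lookup_single when_def)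

lemma weyl_mult_W:
  "weyl_mult s (weyl_W f) (weyl_W g) =
     weyl_scale (exp (- (\<i> / 2) * complex_of_real (s f g))) (weyl_W (f + g))"
  by (simp add: weyl_mult_def weyl_W_def weyl_scale_single)

lemma weyl_star_W: "weyl_star (weyl_W f) = weyl_W (- f)"
  by (simp add: weyl_star_def weyl_W_def)

text \<open>Normalized positive linear functionals on \<open>\<Delta>(E, s)\<close>; the unit is \<open>W(0)\<close>.\<close>

definition weyl_state ::
  "('e::real_vector \<Rightarrow> 'e \<Rightarrow> real) \<Rightarrow> (('e \<Rightarrow>\<^sub>0 complex) \<Rightarrow> complex) \<Rightarrow> bool" where
  "weyl_state s \<omega> \<longleftrightarrow>
     (\<forall>A B. \<omega> (A + B) = \<omega> A + \<omega> B) \<and>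
     (\<forall>c A. \<omega> (weyl_scale c A) = c * \<omega> A) \<and>
     (\<forall>A. \<omega> (weyl_mult s (weyl_star A) A) \<in> \<real>\<^sub>\<ge>\<^sub>0) \<and>
     \<omega> (weyl_W 0) = 1"

definition weyl_norm :: "('e::real_vector \<Rightarrow> 'e \<Rightarrow> real) \<Rightarrow> ('e \<Rightarrow>\<^sub>0 complex) \<Rightarrow> real" where
  "weyl_norm s A = (SUP \<omega>\<in>{\<omega>. weyl_state s \<omega>}. sqrt (Re (\<omega> (weyl_mult s (weyl_star A) A))))"


subsection \<open>The Weyl C*-algebra \<open>\<W>(E, s)\<close>\<close>

text \<open>
  The completion of \<open>\<Delta>(E, s)\<close> in \<open>weyl_norm s\<close>: classes of Cauchy sequences modulo null
  sequences. It depends on \<open>s\<close>, hence cannot be a type and is given by a carrier.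
\<close>

definition weyl_Cauchy ::
  "('e::real_vector \<Rightarrow> 'e \<Rightarrow> real) \<Rightarrow> (nat \<Rightarrow> ('e \<Rightarrow>\<^sub>0 complex)) set" where
  "weyl_Cauchy s =
     {a. \<forall>e>0. \<exists>N. \<forall>m\<ge>N. \<forall>n\<ge>N. weyl_norm s (a m - a n) < e}"

definition weyl_rel ::
  "('e::real_vector \<Rightarrow> 'e \<Rightarrow> real) \<Rightarrow> (nat \<Rightarrow> ('e \<Rightarrow>\<^sub>0 complex)) rel" where
  "weyl_rel s = {(a, b). a \<in> weyl_Cauchy s \<and> b \<in> weyl_Cauchy s \<and>
                        (\<lambda>n. weyl_norm s (a n - b n)) \<longlonglongrightarrow> 0}"

definition weyl_class ::
  "('e::real_vector \<Rightarrow> 'e \<Rightarrow> real) \<Rightarrow> (nat \<Rightarrow> ('e \<Rightarrow>\<^sub>0 complex))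
     \<Rightarrow> (nat \<Rightarrow> ('e \<Rightarrow>\<^sub>0 complex)) set" where
  "weyl_class s a = weyl_rel s `` {a}"

record 'b normed_star_algebra = "(complex, 'b) module" +
  star :: "'b \<Rightarrow> 'b"
  cnorm :: "'b \<Rightarrow> real"

definition weyl_algebra ::
  "('e::real_vector \<Rightarrow> 'e \<Rightarrow> real) \<Rightarrow> ((nat \<Rightarrow> ('e \<Rightarrow>\<^sub>0 complex)) set) normed_star_algebra" where
  "weyl_algebra s =
     \<lparr> carrier = weyl_Cauchy s // weyl_rel s,
       monoid.mult = (\<lambda>X Y. \<Union>a\<in>X. \<Union>b\<in>Y. weyl_class s (\<lambda>n. weyl_mult s (a n) (b n))),
       one = weyl_class s (\<lambda>n. weyl_W 0),
       ring.zero = weyl_class s (\<lambda>n. 0),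
       add = (\<lambda>X Y. \<Union>a\<in>X. \<Union>b\<in>Y. weyl_class s (\<lambda>n. a n + b n)),
       smult = (\<lambda>c X. \<Union>a\<in>X. weyl_class s (\<lambda>n. weyl_scale c (a n))),
       star = (\<lambda>X. \<Union>a\<in>X. weyl_class s (\<lambda>n. weyl_star (a n))),
       cnorm = (\<lambda>X. THE r. \<forall>a\<in>X. (\<lambda>n. weyl_norm s (a n)) \<longlonglongrightarrow> r) \<rparr>"

definition weyl_gen ::
  "('e::real_vector \<Rightarrow> 'e \<Rightarrow> real) \<Rightarrow> 'e \<Rightarrow> (nat \<Rightarrow> ('e \<Rightarrow>\<^sub>0 complex)) set" where
  "weyl_gen s f = weyl_class s (\<lambda>n. weyl_W f)"


subsection \<open>The quantization map\<close>

definition linear_map ::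
  "('a, 'm) normed_star_algebra_scheme \<Rightarrow> ('b, 'n) normed_star_algebra_scheme
     \<Rightarrow> ('a \<Rightarrow> 'b) \<Rightarrow> bool" where
  "linear_map A B T \<longleftrightarrow>
     T \<in> carrier A \<rightarrow> carrier B \<and>
     (\<forall>x\<in>carrier A. \<forall>y\<in>carrier A. T (x \<oplus>\<^bsub>A\<^esub> y) = T x \<oplus>\<^bsub>B\<^esub> T y) \<and>
     (\<forall>c. \<forall>x\<in>carrier A. T (c \<odot>\<^bsub>A\<^esub> x) = c \<odot>\<^bsub>B\<^esub> T x)"

definition norm_dist :: "('a, 'm) normed_star_algebra_scheme \<Rightarrow> 'a \<Rightarrow> 'a \<Rightarrow> real" where
  "norm_dist A x y = cnorm A (x \<oplus>\<^bsub>A\<^esub> ((- 1) \<odot>\<^bsub>A\<^esub> y))"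

definition norm_continuous ::
  "('a, 'm) normed_star_algebra_scheme \<Rightarrow> ('b, 'n) normed_star_algebra_scheme
     \<Rightarrow> ('a \<Rightarrow> 'b) \<Rightarrow> bool" where
  "norm_continuous A B T \<longleftrightarrow>
     (\<forall>x\<in>carrier A. \<forall>e>0. \<exists>d>0. \<forall>y\<in>carrier A.
        norm_dist A y x < d \<longrightarrow> norm_dist B (T y) (T x) < e)"

definition Weyl :: "real \<Rightarrow>
    ((nat \<Rightarrow> ('h::complex_hilbert_space \<Rightarrow>\<^sub>0 complex)) set) normed_star_algebra" where
  "Weyl h = weyl_algebra (\<lambda>f g. h * symp f g)"

definition Weyl_gen :: "real \<Rightarrow> 'h::complex_hilbert_space
    \<Rightarrow> (nat \<Rightarrow> ('h \<Rightarrow>\<^sub>0 complex)) set" where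
  "Weyl_gen h f = weyl_gen (\<lambda>f g. h * symp f g) f"

definition is_quantization_map :: "real \<Rightarrow>
    ((nat \<Rightarrow> ('h::complex_hilbert_space \<Rightarrow>\<^sub>0 complex)) set
       \<Rightarrow> (nat \<Rightarrow> ('h \<Rightarrow>\<^sub>0 complex)) set) \<Rightarrow> bool" where
  "is_quantization_map h Q \<longleftrightarrow>
     linear_map (Weyl 0) (Weyl h) Q \<and> norm_continuous (Weyl 0) (Weyl h) Q \<and>
     (\<forall>f::'h. Q (Weyl_gen 0 f) =
        complex_of_real (exp (- (h / 4) * (norm f)\<^sup>2)) \<odot>\<^bsub>Weyl h\<^esub> Weyl_gen h f)"

end

theory Submission
  imports Defs "HOL-Real_Asymp.Real_Asymp"
begin

text \<open>
  The coefficient of \<open>W(g)\<close> is bounded by the norm (use the tracial state), so it extends to a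
  continuous functional on \<open>\<W>(E, s)\<close>, and \<open>Q\<^sub>h\<close> multiplies it by \<open>exp (- h/4 \<parallel>g\<parallel>\<^sup>2) \<noteq> 0\<close>.
  Injectivity thus reduces to the fact that an element of the completion is determined by its
  coefficients. This holds because \<open>W(k) \<mapsto> \<phi>(k) W(k)\<close> is contractive for the finitely
  supported positive definite functions \<open>\<phi>(k) = card (F \<inter> (F - k)) / card F\<close>, which tend to \<open>1\<close>
  along Folner sets \<open>F\<close> of the abelian group \<open>E\<close>. For \<open>f \<noteq> 0\<close> a preimage of
  \<open>\<Sum>\<^sub>k 2\<^sup>-\<^sup>k W(k f)\<close> would have the unbounded coefficients \<open>2\<^sup>-\<^sup>k exp (h/4 k\<^sup>2 \<parallel>f\<parallel>\<^sup>2)\<close>.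
\<close>

section \<open>Coefficients of elements of \<Delta>(E, s)\<close>

lemma lookup_weyl_scale [simp]:
  "Poly_Mapping.lookup (weyl_scale c A) f = c * Poly_Mapping.lookup A f"
  by (simp add: weyl_scale_def Poly_Mapping.map.rep_eq when_def)

lemma poly_mapping_eq_sum_W:
  fixes A :: "'e::real_vector \<Rightarrow>\<^sub>0 complex"
  assumes "finite S" "Poly_Mapping.keys A \<subseteq> S"
  shows "A = (\<Sum>f\<in>S. weyl_scale (Poly_Mapping.lookup A f) (weyl_W f))"
proof (rule poly_mapping_eqI)
  fix k
  have "(\<Sum>f\<in>S. Poly_Mapping.lookup A f * (1 when f = k)) = Poly_Mapping.lookup A k"
  proof (cases "k \<in> S")
    case True
    then show ?thesis
      using assms(1) by (simp add: when_def if_distrib cong: if_cong)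
  next
    case False
    then have "Poly_Mapping.lookup A k = 0"
      using assms(2) by (auto simp: in_keys_iff)
    then show ?thesis
      using False by (auto simp: when_def intro!: sum.neutral)
  qed
  then show "Poly_Mapping.lookup A k =
      Poly_Mapping.lookup (\<Sum>f\<in>S. weyl_scale (Poly_Mapping.lookup A f) (weyl_W f)) k"
    by (simp add: lookup_sum weyl_W_def lookup_single)
qed

text \<open>Fourier multipliers in the basis W(f). Two kinds of symbol \<open>u\<close> occur below:
  indicators of sets, which cut the support down, and averages of such indicators.\<close>

definition weyl_multiplier ::
  "('e::real_vector \<Rightarrow> complex) \<Rightarrow> ('e \<Rightarrow>\<^sub>0 complex) \<Rightarrow> ('e \<Rightarrow>\<^sub>0 complex)" where
  "weyl_multiplier u A =
     (\<Sum>f\<in>Poly_Mapping.keys A. weyl_scale (u f * Poly_Mapping.lookup A f) (weyl_W f))"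

lemma lookup_weyl_multiplier [simp]:
  "Poly_Mapping.lookup (weyl_multiplier u A) k = u k * Poly_Mapping.lookup A k"
proof -
  have "(\<Sum>f\<in>Poly_Mapping.keys A. u f * Poly_Mapping.lookup A f * (1 when f = k))
      = u k * Poly_Mapping.lookup A k"
    by (cases "k \<in> Poly_Mapping.keys A")
      (auto simp: when_def if_distrib in_keys_iff cong: if_cong intro!: sum.neutral)
  then show ?thesis
    by (simp add: weyl_multiplier_def lookup_sum weyl_W_def lookup_single)
qed

lemma keys_weyl_multiplier_subset:
  "Poly_Mapping.keys (weyl_multiplier u A) \<subseteq> Poly_Mapping.keys A"
  by (auto simp: in_keys_iff)

lemma lookup_weyl_star: "Poly_Mapping.lookup (weyl_star A) f = cnj (Poly_Mapping.lookup A (- f))"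
proof -
  have "Poly_Mapping.lookup (weyl_star A) f =
      (\<Sum>k\<in>Poly_Mapping.keys A. if k = - f then cnj (Poly_Mapping.lookup A k) else 0)"
    unfolding weyl_star_def lookup_sum lookup_single when_def
    by (intro sum.cong refl) (auto simp: minus_equation_iff)
  also have "\<dots> = cnj (Poly_Mapping.lookup A (- f))"
    by (simp add: in_keys_iff)
  finally show ?thesis .
qed

lemma keys_weyl_star: "Poly_Mapping.keys (weyl_star A) = uminus ` Poly_Mapping.keys A"
  by (force simp: in_keys_iff lookup_weyl_star image_iff intro: bexI[of _ "- _"])

text \<open>\<open>S\<close> may exceed the support, so that several elements can be expanded over
  one common index set.\<close>

lemma weyl_star_mult_self:
  assumes "finite S" "Poly_Mapping.keys A \<subseteq> S"
  shows "weyl_mult s (weyl_star A) A =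
    (\<Sum>f\<in>S. \<Sum>g\<in>S. weyl_scale (cnj (Poly_Mapping.lookup A f) * Poly_Mapping.lookup A g *
        exp (- (\<i> / 2) * complex_of_real (s (- f) g))) (weyl_W (g - f)))"
proof -
  have "weyl_mult s (weyl_star A) A =
    (\<Sum>f\<in>Poly_Mapping.keys A. \<Sum>g\<in>Poly_Mapping.keys A.
      weyl_scale (cnj (Poly_Mapping.lookup A f) * Poly_Mapping.lookup A g *
        exp (- (\<i> / 2) * complex_of_real (s (- f) g))) (weyl_W (g - f)))"
    unfolding weyl_mult_def keys_weyl_star
    by (subst sum.reindex)
      (simp_all add: inj_on_def lookup_weyl_star weyl_scale_single weyl_W_def)
  also have "\<dots> = (\<Sum>f\<in>Poly_Mapping.keys A. \<Sum>g\<in>S.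
      weyl_scale (cnj (Poly_Mapping.lookup A f) * Poly_Mapping.lookup A g *
        exp (- (\<i> / 2) * complex_of_real (s (- f) g))) (weyl_W (g - f)))"
    using assms by (intro sum.cong refl sum.mono_neutral_left)
      (auto simp: in_keys_iff weyl_scale_single weyl_W_def)
  also have "\<dots> = (\<Sum>f\<in>S. \<Sum>g\<in>S.
      weyl_scale (cnj (Poly_Mapping.lookup A f) * Poly_Mapping.lookup A g *
        exp (- (\<i> / 2) * complex_of_real (s (- f) g))) (weyl_W (g - f)))"
    using assms by (intro sum.mono_neutral_left)
      (auto simp: in_keys_iff weyl_scale_single weyl_W_def intro!: sum.neutral)
  finally show ?thesis .
qed

subsection \<open>States\<close>

lemma weyl_stateD:
  assumes "weyl_state s \<omega>"
  shows weyl_state_add: "\<omega> (A + B) = \<omega> A + \<omega> B"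
    and weyl_state_scale: "\<omega> (weyl_scale c A) = c * \<omega> A"
    and weyl_state_nonneg: "0 \<le> Re (\<omega> (weyl_mult s (weyl_star A) A))"
    and weyl_state_unit: "\<omega> (weyl_W 0) = 1"
  using assms by (auto simp: weyl_state_def complex_nonneg_Reals_iff)

text \<open>The Gram kernel \<omega>(W(-f) W(g)), where W(-f) is the adjoint of W(f). Positivity of
  \<omega> means that this kernel is positive semidefinite.\<close>

definition state_kernel ::
  "('e::real_vector \<Rightarrow> 'e \<Rightarrow> real) \<Rightarrow> (('e \<Rightarrow>\<^sub>0 complex) \<Rightarrow> complex) \<Rightarrow> 'e \<Rightarrow> 'e \<Rightarrow> complex"
  where "state_kernel s \<omega> f g =
     exp (- (\<i> / 2) * complex_of_real (s (- f) g)) * \<omega> (weyl_W (g - f))"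

text \<open>Stated for linear functionals, so that it also serves to prove positivity of
  \<open>trace\<close> and of the composition of a state with \<open>fejer_op F\<close>.\<close>

lemma weyl_state_star_mult_self:
  assumes "\<And>A B. \<omega> (A + B) = \<omega> A + \<omega> B" "\<And>c A. \<omega> (weyl_scale c A) = c * \<omega> A"
    and "finite S" "Poly_Mapping.keys A \<subseteq> S"
  shows "\<omega> (weyl_mult s (weyl_star A) A) =
    (\<Sum>f\<in>S. \<Sum>g\<in>S. cnj (Poly_Mapping.lookup A f) * Poly_Mapping.lookup A g * state_kernel s \<omega> f g)"
proof -
  have 0: "\<omega> 0 = 0"
    using assms(1)[of 0 0] by simp
  have "\<omega> (sum B I) = (\<Sum>i\<in>I. \<omega> (B i))" for B and I :: "'a set"
    by (induction I rule: infinite_finite_induct) (simp_all add: 0 assms(1))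
  then show ?thesis
    unfolding weyl_star_mult_self[OF assms(3,4)]
    by (simp add: assms(2) state_kernel_def mult.assoc)
qed

text \<open>The GNS seminorm: the length of the vector that A represents in the GNS space of
  \<omega>. The norm \<open>weyl_norm\<close> is the supremum of these seminorms.\<close>

definition state_seminorm ::
  "('e::real_vector \<Rightarrow> 'e \<Rightarrow> real) \<Rightarrow> (('e \<Rightarrow>\<^sub>0 complex) \<Rightarrow> complex) \<Rightarrow> ('e \<Rightarrow>\<^sub>0 complex) \<Rightarrow> real"
  where "state_seminorm s \<omega> A = sqrt (Re (\<omega> (weyl_mult s (weyl_star A) A)))"

lemma state_seminorm_nonneg: "weyl_state s \<omega> \<Longrightarrow> 0 \<le> state_seminorm s \<omega> A"
  by (simp add: state_seminorm_def weyl_state_nonneg)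

lemma state_seminorm_power2:
  "weyl_state s \<omega> \<Longrightarrow> (state_seminorm s \<omega> A)\<^sup>2 = Re (\<omega> (weyl_mult s (weyl_star A) A))"
  by (simp add: state_seminorm_def weyl_state_nonneg)

text \<open>Nonnegativity of a real quadratic polynomial yields the Cauchy-Schwarz bound on its
  middle coefficient, and this gives the Minkowski inequality.\<close>

lemma sqrt_quadratic_triangle:
  fixes a b r :: real
  assumes nonneg: "\<And>t. 0 \<le> a + 2 * t * r + t\<^sup>2 * b" and b: "0 \<le> b"
  shows "sqrt (a + 2 * r + b) \<le> sqrt a + sqrt b"
proof -
  have a: "0 \<le> a"
    using nonneg[of 0] by simp
  have "r \<le> sqrt a * sqrt b"
  proof (cases "b = 0")
    case True
    have "r = 0"
    proof (rule ccontr)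
      assume "r \<noteq> 0"
      then show False
        \<comment> \<open>With b = 0 the polynomial is affine in t; at this t its value is
          -1.\<close>
        using nonneg[of "- (a + 1) / (2 * r)"] True by (simp add: field_simps)
    qed
    then show ?thesis by (simp add: a b)
  next
    case False
    have "0 \<le> a - r\<^sup>2 / b"
      \<comment> \<open>The vertex of the parabola.\<close>
      using nonneg[of "- r / b"] False by (simp add: power2_eq_square field_simps)
    then have "r\<^sup>2 \<le> a * b"
      using b False by (simp add: field_simps)
    then show ?thesis
      by (metis real_le_rsqrt real_sqrt_mult)
  qed
  then have "a + 2 * r + b \<le> (sqrt a + sqrt b)\<^sup>2"
    using a b by (simp add: power2_sum)
  then show ?thesis
    by (intro real_le_lsqrt) (use a b in auto)
qed

lemma state_seminorm_scale:
  assumes "weyl_state s \<omega>"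
  shows "state_seminorm s \<omega> (weyl_scale c A) = cmod c * state_seminorm s \<omega> A"
proof -
  let ?S = "Poly_Mapping.keys A \<union> Poly_Mapping.keys (weyl_scale c A)"
  note lin = weyl_state_add[OF assms] weyl_state_scale[OF assms]
  have "\<omega> (weyl_mult s (weyl_star (weyl_scale c A)) (weyl_scale c A)) =
      (cnj c * c) * \<omega> (weyl_mult s (weyl_star A) A)"
    by (simp add: weyl_state_star_mult_self[OF lin, of ?S] sum_distrib_left mult_ac)
  also have "cnj c * c = complex_of_real ((cmod c)\<^sup>2)"
    using complex_norm_square[of c] by (simp add: mult.commute)
  finally show ?thesis
    by (simp add: state_seminorm_def real_sqrt_mult)
qed

text \<open>The squared seminorm of A + t B is a nonnegative quadratic polynomial in the real
  variable t, so \<open>sqrt_quadratic_triangle\<close> applies; t = 1 gives the claim.\<close>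

lemma state_seminorm_triangle:
  assumes "weyl_state s \<omega>"
  shows "state_seminorm s \<omega> (A + B) \<le> state_seminorm s \<omega> A + state_seminorm s \<omega> B"
proof -
  let ?S = "Poly_Mapping.keys A \<union> Poly_Mapping.keys B"
  let ?l = Poly_Mapping.lookup and ?K = "state_kernel s \<omega>"
  define q where "q = (\<lambda>A. Re (\<omega> (weyl_mult s (weyl_star A) A)))"
  \<comment> \<open>Half the real part of the two mixed terms taken together, so that the
    coefficient of t is read off directly from the expansion.\<close>
  define r where "r = Re (\<Sum>f\<in>?S. \<Sum>g\<in>?S. (cnj (?l A f) * ?l B g + cnj (?l B f) * ?l A g) * ?K f g) / 2"
  note lin = weyl_state_add[OF assms] weyl_state_scale[OF assms]
  have expand: "q (A + weyl_scale (complex_of_real t) B) = q A + 2 * t * r + t\<^sup>2 * q B" for t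
  proof -
    let ?C = "A + weyl_scale (complex_of_real t) B"
    have keys: "Poly_Mapping.keys ?C \<subseteq> ?S"
      by (auto simp: in_keys_iff lookup_add)
    have "\<omega> (weyl_mult s (weyl_star ?C) ?C) = (\<Sum>f\<in>?S. \<Sum>g\<in>?S.
        cnj (?l A f) * ?l A g * ?K f g
        + complex_of_real t * ((cnj (?l A f) * ?l B g + cnj (?l B f) * ?l A g) * ?K f g)
        + (complex_of_real t)\<^sup>2 * (cnj (?l B f) * ?l B g * ?K f g))"
      unfolding weyl_state_star_mult_self[OF lin _ keys, simplified]
      by (intro sum.cong refl) (simp add: lookup_add algebra_simps power2_eq_square)
    also have "\<dots> = \<omega> (weyl_mult s (weyl_star A) A)
        + complex_of_real t * (\<Sum>f\<in>?S. \<Sum>g\<in>?S. (cnj (?l A f) * ?l B g + cnj (?l B f) * ?l A g) * ?K f g)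
        + complex_of_real (t\<^sup>2) * \<omega> (weyl_mult s (weyl_star B) B)"
      by (simp only: weyl_state_star_mult_self[OF lin, of ?S] finite_UnI finite_keys Un_upper1 Un_upper2
        sum.distrib sum_distrib_left of_real_power)
    finally show ?thesis
      by (simp add: q_def r_def)
  qed
  have "sqrt (q A + 2 * r + q B) \<le> sqrt (q A) + sqrt (q B)"
  proof (rule sqrt_quadratic_triangle)
    show "0 \<le> q A + 2 * t * r + t\<^sup>2 * q B" for t
      using weyl_state_nonneg[OF assms, of "A + weyl_scale (complex_of_real t) B"]
      unfolding expand[symmetric] by (simp add: q_def)
  qed (simp add: q_def weyl_state_nonneg[OF assms])
  moreover have "weyl_scale 1 B = B"
    by (rule poly_mapping_eqI) simp
  ultimately show ?thesis
    using expand[of 1] by (simp add: state_seminorm_def q_def)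
qed

lemma state_seminorm_zero:
  assumes "weyl_state s \<omega>"
  shows "state_seminorm s \<omega> 0 = 0"
proof -
  have "weyl_scale 0 0 = (0 :: 'a \<Rightarrow>\<^sub>0 complex)"
    by (rule poly_mapping_eqI) simp
  then show ?thesis
    using state_seminorm_scale[OF assms, of 0 0] by simp
qed

lemma state_seminorm_sum:
  assumes "weyl_state s \<omega>"
  shows "state_seminorm s \<omega> (sum A I) \<le> (\<Sum>i\<in>I. state_seminorm s \<omega> (A i))"
  by (induction I rule: infinite_finite_induct)
    (auto simp: state_seminorm_zero[OF assms]
      intro: order_trans[OF state_seminorm_triangle[OF assms]])

text \<open>The axiom removes the phase from W(-f) W(f), so that this product is W(0). The estimates
  below use the form only through it, so W(E, 0) and W(E, h \<sigma>) are treated at once.\<close>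

locale weyl_form =
  fixes s :: "'e::real_vector \<Rightarrow> 'e \<Rightarrow> real"
  assumes form_minus_self: "s (- f) f = 0"
begin

lemma state_seminorm_W:
  assumes "weyl_state s \<omega>"
  shows "state_seminorm s \<omega> (weyl_W f) = 1"
proof -
  have "\<omega> (weyl_mult s (weyl_star (weyl_W f)) (weyl_W f)) = 1"
    using weyl_state_star_mult_self[OF weyl_state_add[OF assms] weyl_state_scale[OF assms],
        of "{f}" "weyl_W f"] assms
    by (simp add: weyl_W_def state_kernel_def form_minus_self weyl_state_def)
  then show ?thesis
    by (simp add: state_seminorm_def)
qed

text \<open>The bound does not depend on \<omega>. It makes the supremum in \<open>weyl_norm\<close>
  finite, and later turns convergence of finitely many coefficients into norm convergence.\<close>

lemma state_seminorm_le_l1: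
  assumes "weyl_state s \<omega>" "finite S" "Poly_Mapping.keys A \<subseteq> S"
  shows "state_seminorm s \<omega> A \<le> (\<Sum>f\<in>S. cmod (Poly_Mapping.lookup A f))"
proof -
  have "state_seminorm s \<omega> A =
      state_seminorm s \<omega> (\<Sum>f\<in>S. weyl_scale (Poly_Mapping.lookup A f) (weyl_W f))"
    using poly_mapping_eq_sum_W[OF assms(2,3)] by simp
  also have "\<dots> \<le> (\<Sum>f\<in>S. state_seminorm s \<omega> (weyl_scale (Poly_Mapping.lookup A f) (weyl_W f)))"
    by (rule state_seminorm_sum[OF assms(1)])
  finally show ?thesis
    by (simp add: state_seminorm_scale[OF assms(1)] state_seminorm_W[OF assms(1)])
qed

abbreviation trace :: "('e \<Rightarrow>\<^sub>0 complex) \<Rightarrow> complex" where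
  "trace A \<equiv> Poly_Mapping.lookup A 0"

text \<open>Only the terms with f = g contribute to the coefficient of W(0), and their phase is 1.
  Hence the GNS seminorm of the trace is the l2 norm of the coefficients.\<close>

lemma trace_star_mult_self:
  "trace (weyl_mult s (weyl_star A) A) =
     complex_of_real (\<Sum>f\<in>Poly_Mapping.keys A. (cmod (Poly_Mapping.lookup A f))\<^sup>2)"
proof -
  have "trace (weyl_mult s (weyl_star A) A) = (\<Sum>f\<in>Poly_Mapping.keys A. \<Sum>g\<in>Poly_Mapping.keys A.
      cnj (Poly_Mapping.lookup A f) * Poly_Mapping.lookup A g * state_kernel s trace f g)"
    by (rule weyl_state_star_mult_self) (auto simp: lookup_add)
  also have "\<dots> = (\<Sum>f\<in>Poly_Mapping.keys A. \<Sum>g\<in>Poly_Mapping.keys A.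
      if f = g then cnj (Poly_Mapping.lookup A f) * Poly_Mapping.lookup A f else 0)"
    by (intro sum.cong refl)
      (auto simp: state_kernel_def weyl_W_def lookup_single when_def form_minus_self)
  also have "\<dots> = (\<Sum>f\<in>Poly_Mapping.keys A. complex_of_real ((cmod (Poly_Mapping.lookup A f))\<^sup>2))"
    using complex_norm_square by (intro sum.cong refl) (simp add: mult.commute)
  finally show ?thesis by simp
qed

lemma weyl_state_trace: "weyl_state s trace"
  unfolding weyl_state_def trace_star_mult_self nonneg_Reals_of_real_iff
  by (auto simp: lookup_add weyl_W_def intro: sum_nonneg)

section \<open>Basic estimates for the norm on \<Delta>(E, s)\<close>

lemma bdd_above_state_seminorm: "bdd_above ((\<lambda>\<omega>. state_seminorm s \<omega> A) ` {\<omega>. weyl_state s \<omega>})"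
  by (rule bdd_aboveI2[where M = "\<Sum>f\<in>Poly_Mapping.keys A. cmod (Poly_Mapping.lookup A f)"])
    (auto intro: state_seminorm_le_l1)

lemma weyl_norm_eq: "weyl_norm s A = (SUP \<omega>\<in>{\<omega>. weyl_state s \<omega>}. state_seminorm s \<omega> A)"
  by (simp add: weyl_norm_def state_seminorm_def)

lemma state_seminorm_le_weyl_norm: "weyl_state s \<omega> \<Longrightarrow> state_seminorm s \<omega> A \<le> weyl_norm s A"
  unfolding weyl_norm_eq by (rule cSUP_upper[OF _ bdd_above_state_seminorm]) simp

text \<open>A supremum of reals can be bounded this way only over a nonempty set; the trace supplies
  a state.\<close>

lemma weyl_norm_leI: "(\<And>\<omega>. weyl_state s \<omega> \<Longrightarrow> state_seminorm s \<omega> A \<le> c) \<Longrightarrow> weyl_norm s A \<le> c"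
  unfolding weyl_norm_eq using weyl_state_trace by (intro cSUP_least) auto

lemma weyl_norm_nonneg: "0 \<le> weyl_norm s A"
  using state_seminorm_nonneg[OF weyl_state_trace] state_seminorm_le_weyl_norm[OF weyl_state_trace]
  by (rule order_trans)

lemma weyl_norm_le_l1:
  "finite S \<Longrightarrow> Poly_Mapping.keys A \<subseteq> S \<Longrightarrow> weyl_norm s A \<le> (\<Sum>f\<in>S. cmod (Poly_Mapping.lookup A f))"
  by (intro weyl_norm_leI state_seminorm_le_l1)

lemma weyl_norm_triangle: "weyl_norm s (A + B) \<le> weyl_norm s A + weyl_norm s B"
  by (rule weyl_norm_leI)
    (meson add_mono order_trans state_seminorm_le_weyl_norm state_seminorm_triangle)

lemma weyl_norm_scale_le: "weyl_norm s (weyl_scale c A) \<le> cmod c * weyl_norm s A"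
  by (rule weyl_norm_leI)
    (simp add: state_seminorm_scale mult_left_mono state_seminorm_le_weyl_norm)

lemma weyl_norm_zero [simp]: "weyl_norm s 0 = 0"
  using weyl_norm_le_l1[of "{}" 0] weyl_norm_nonneg[of 0] by simp

lemma weyl_norm_uminus [simp]: "weyl_norm s (- A) = weyl_norm s A"
proof -
  have "weyl_norm s (- B) \<le> weyl_norm s B" for B
  proof -
    have "- B = weyl_scale (- 1) B"
      by (rule poly_mapping_eqI) simp
    then show ?thesis
      using weyl_norm_scale_le[of "- 1" B] by simp
  qed
  from this[of A] this[of "- A"] show ?thesis by simp
qed

lemma weyl_norm_minus_commute: "weyl_norm s (A - B) = weyl_norm s (B - A)"
  using weyl_norm_uminus[of "A - B"] by simp

lemma weyl_norm_triangle_diff: "weyl_norm s (A - C) \<le> weyl_norm s (A - B) + weyl_norm s (B - C)"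
  using weyl_norm_triangle[of "A - B" "B - C"] by simp

text \<open>A single coefficient is at most the l2 norm of all of them, which is the seminorm of the
  tracial state.\<close>

lemma cmod_lookup_le_weyl_norm: "cmod (Poly_Mapping.lookup A f) \<le> weyl_norm s A"
proof (cases "f \<in> Poly_Mapping.keys A")
  case True
  then have "(cmod (Poly_Mapping.lookup A f))\<^sup>2 \<le>
      (\<Sum>f\<in>Poly_Mapping.keys A. (cmod (Poly_Mapping.lookup A f))\<^sup>2)"
    by (intro member_le_sum) auto
  then have "cmod (Poly_Mapping.lookup A f) \<le> state_seminorm s trace A"
    by (simp add: state_seminorm_def trace_star_mult_self real_le_rsqrt)
  then show ?thesis
    using state_seminorm_le_weyl_norm[OF weyl_state_trace] order_trans by blast
qed (simp add: in_keys_iff weyl_norm_nonneg)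

end

subsection \<open>Fejer multipliers\<close>

text \<open>The normalized autocorrelation of the indicator of F. For F an interval of n consecutive
  integers it would be max(0, 1 - |k|/n), the coefficients of the classical Fejer kernel.\<close>

definition fejer :: "'e::real_vector set \<Rightarrow> 'e \<Rightarrow> real" where
  "fejer F k = card {z \<in> F. z + k \<in> F} / card F"

definition fejer_op :: "'e::real_vector set \<Rightarrow> ('e \<Rightarrow>\<^sub>0 complex) \<Rightarrow> ('e \<Rightarrow>\<^sub>0 complex)" where
  "fejer_op F = weyl_multiplier (\<lambda>k. complex_of_real (fejer F k))"

definition translate_indicator :: "'e::real_vector set \<Rightarrow> 'e \<Rightarrow> 'e \<Rightarrow> complex" where
  "translate_indicator F z f = of_bool (z + f \<in> F)"

lemma cnj_translate_indicator [simp]: "cnj (translate_indicator F z f) = translate_indicator F z f"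
  by (simp add: translate_indicator_def)

lemma fejer_eq_sum_translate_indicator:
  assumes "finite F"
  shows "complex_of_real (fejer F k) = (\<Sum>z\<in>F. translate_indicator F z k) / card F"
  using assms by (simp add: fejer_def translate_indicator_def Int_def flip: of_nat_sum)

text \<open>This is positive definiteness: the values at differences g - f form a Gram matrix of
  indicators of translates of F. The sum is really over the whole group; \<open>Z\<close> is a
  finite set containing every z with z + f in F.\<close>

lemma fejer_diff:
  assumes "finite Z" "\<And>x. x \<in> F \<Longrightarrow> x - f \<in> Z"
  shows "complex_of_real (fejer F (g - f)) =
    (\<Sum>z\<in>Z. translate_indicator F z f * translate_indicator F z g) / card F"
proof -
  \<comment> \<open>Shifting by f turns the two conditions z + f, z + g in F into y, y + (g - f) in
    F.\<close>
  have "bij_betw (\<lambda>z. z + f) {z \<in> Z. z + f \<in> F \<and> z + g \<in> F} {y \<in> F. y + (g - f) \<in> F}"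
    using assms(2) by (intro bij_betwI[where g = "\<lambda>y. y - f"]) (auto simp: algebra_simps)
  then have "card {z \<in> Z. z + f \<in> F \<and> z + g \<in> F} = card {y \<in> F. y + (g - f) \<in> F}"
    by (rule bij_betw_same_card)
  moreover have "(\<Sum>z\<in>Z. translate_indicator F z f * translate_indicator F z g) =
      of_nat (card {z \<in> Z. z + f \<in> F \<and> z + g \<in> F})"
    using assms(1) by (simp add: translate_indicator_def Int_def flip: of_bool_conj of_nat_sum)
  ultimately show ?thesis
    by (simp add: fejer_def)
qed

lemma fejer_zero: "finite F \<Longrightarrow> F \<noteq> {} \<Longrightarrow> fejer F 0 = 1"
  by (simp add: fejer_def)

lemma fejer_le_1: "finite F \<Longrightarrow> fejer F k \<le> 1"
  by (simp add: fejer_def divide_le_eq_1 card_mono card_gt_0_iff)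

lemma lookup_fejer_op [simp]:
  "Poly_Mapping.lookup (fejer_op F A) k = complex_of_real (fejer F k) * Poly_Mapping.lookup A k"
  by (simp add: fejer_op_def)

lemma finite_fejer_support:
  assumes "finite F"
  shows "finite {k. fejer F k \<noteq> 0}"
proof (rule finite_subset)
  show "{k. fejer F k \<noteq> 0} \<subseteq> (\<lambda>(x, y). y - x) ` (F \<times> F)"
  proof
    fix k
    assume "k \<in> {k. fejer F k \<noteq> 0}"
    then have "{z \<in> F. z + k \<in> F} \<noteq> {}"
      by (force simp: fejer_def)
    then obtain z where "z \<in> F" "z + k \<in> F" by blast
    then show "k \<in> (\<lambda>(x, y). y - x) ` (F \<times> F)"
      by (intro image_eqI[of _ _ "(z, z + k)"]) auto
  qed
qed (use assms in auto)

text \<open>A linear average of cutoffs over shifts in F alone, in contrast to the quadratic average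
  over all shifts in \<open>state_fejer_op_star_mult_self\<close>. Comparing the two gives
  contractivity.\<close>

lemma fejer_op_eq_average:
  assumes "finite F"
  shows "fejer_op F A =
    weyl_scale (inverse (of_nat (card F))) (\<Sum>z\<in>F. weyl_multiplier (translate_indicator F z) A)"
  by (rule poly_mapping_eqI)
    (simp add: lookup_sum fejer_eq_sum_translate_indicator[OF assms] sum_distrib_left sum_distrib_right divide_simps mult_ac)

lemma fejer_op_add: "fejer_op F (A + B) = fejer_op F A + fejer_op F B"
  by (rule poly_mapping_eqI) (simp add: lookup_add algebra_simps)

lemma fejer_op_diff: "fejer_op F (A - B) = fejer_op F A - fejer_op F B"
  by (rule poly_mapping_eqI) (simp add: lookup_minus algebra_simps)

lemma fejer_op_scale: "fejer_op F (weyl_scale c A) = weyl_scale c (fejer_op F A)"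
  by (rule poly_mapping_eqI) simp

lemma fejer_op_W: "fejer_op F (weyl_W f) = weyl_scale (complex_of_real (fejer F f)) (weyl_W f)"
  by (rule poly_mapping_eqI) (auto simp: weyl_W_def lookup_single when_def)

text \<open>The kernel of \<omega> is multiplied entrywise by a Gram matrix, as in the Schur product
  theorem. Expanding that matrix over z leaves one positive term for each cutoff of A.\<close>

lemma state_fejer_op_star_mult_self:
  assumes "weyl_state s \<omega>" "finite Z"
    and Z: "\<And>x f. x \<in> F \<Longrightarrow> f \<in> Poly_Mapping.keys A \<Longrightarrow> x - f \<in> Z"
  shows "\<omega> (fejer_op F (weyl_mult s (weyl_star A) A)) =
    (\<Sum>z\<in>Z. \<omega> (weyl_mult s (weyl_star (weyl_multiplier (translate_indicator F z) A))
      (weyl_multiplier (translate_indicator F z) A))) / card F"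
    (is "_ = (\<Sum>z\<in>Z. \<omega> (?q z)) / _")
proof -
  let ?S = "Poly_Mapping.keys A" and ?l = "Poly_Mapping.lookup A" and ?c = "translate_indicator F"
  note lin = weyl_state_add[OF assms(1)] weyl_state_scale[OF assms(1)]
  have "\<omega> (fejer_op F (weyl_mult s (weyl_star A) A)) =
      (\<Sum>f\<in>?S. \<Sum>g\<in>?S. cnj (?l f) * ?l g * state_kernel s (\<lambda>A. \<omega> (fejer_op F A)) f g)"
    by (rule weyl_state_star_mult_self) (simp_all add: fejer_op_add fejer_op_scale lin)
  also have "\<dots> = (\<Sum>f\<in>?S. \<Sum>g\<in>?S. \<Sum>z\<in>Z.
      cnj (?c z f * ?l f) * (?c z g * ?l g) * state_kernel s \<omega> f g / card F)"
  proof (intro sum.cong refl)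
    fix f g
    assume f: "f \<in> ?S"
    \<comment> \<open>Since \<open>fejer_op F\<close> acts diagonally, the kernel of the composed
      functional is that of \<omega> times \<open>fejer F (g - f)\<close>.\<close>
    have "cnj (?l f) * ?l g * state_kernel s (\<lambda>A. \<omega> (fejer_op F A)) f g =
        cnj (?l f) * ?l g * state_kernel s \<omega> f g * complex_of_real (fejer F (g - f))"
      by (simp add: state_kernel_def fejer_op_W lin)
    also have "\<dots> = (\<Sum>z\<in>Z.
        cnj (?c z f * ?l f) * (?c z g * ?l g) * state_kernel s \<omega> f g / card F)"
      using fejer_diff[OF assms(2), of F f g] Z[OF _ f]
      by (simp add: sum_distrib_left sum_divide_distrib mult_ac)
    finally show "cnj (?l f) * ?l g * state_kernel s (\<lambda>A. \<omega> (fejer_op F A)) f g = \<dots>" .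
  qed
  also have "\<dots> = (\<Sum>z\<in>Z. (\<Sum>f\<in>?S. \<Sum>g\<in>?S.
      cnj (?c z f * ?l f) * (?c z g * ?l g) * state_kernel s \<omega> f g) / card F)"
    by (simp only: sum_divide_distrib sum.swap[of _ Z ?S])
  also have "\<dots> = (\<Sum>z\<in>Z. \<omega> (?q z) / card F)"
    by (intro sum.cong refl)
      (simp add: weyl_state_star_mult_self[OF lin _ keys_weyl_multiplier_subset])
  finally show ?thesis
    by (simp add: sum_divide_distrib)
qed

lemma nonneg_Reals_sum:
  "(\<And>i. i \<in> I \<Longrightarrow> f i \<in> \<real>\<^sub>\<ge>\<^sub>0) \<Longrightarrow> (\<Sum>i\<in>I. f i :: complex) \<in> \<real>\<^sub>\<ge>\<^sub>0"
  by (induction I rule: infinite_finite_induct) auto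

text \<open>Positivity comes from the expansion into cutoffs, normalization from
  \<open>fejer F 0 = 1\<close>.\<close>

lemma weyl_state_fejer_op:
  assumes "weyl_state s \<omega>" "finite F" "F \<noteq> {}"
  shows "weyl_state s (\<lambda>A. \<omega> (fejer_op F A))"
proof -
  have "\<omega> (fejer_op F (weyl_mult s (weyl_star A) A)) \<in> \<real>\<^sub>\<ge>\<^sub>0" for A
  proof -
    let ?Z = "(\<lambda>(x, f). x - f) ` (F \<times> Poly_Mapping.keys A)"
    let ?A = "\<lambda>z. weyl_multiplier (translate_indicator F z) A"
    have "\<omega> (fejer_op F (weyl_mult s (weyl_star A) A)) =
        (\<Sum>z\<in>?Z. \<omega> (weyl_mult s (weyl_star (?A z)) (?A z))) / complex_of_real (card F)"
      using assms(2) state_fejer_op_star_mult_self[OF assms(1), of ?Z F A] by force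
    also have "\<dots> \<in> \<real>\<^sub>\<ge>\<^sub>0"
      using assms(1) by (intro nonneg_Reals_divide_I nonneg_Reals_sum) (auto simp: weyl_state_def)
    finally show ?thesis .
  qed
  then show ?thesis
    using assms by (simp add: weyl_state_def fejer_op_add fejer_op_scale fejer_op_W fejer_zero)
qed

text \<open>
  The operator average is dominated by the average over the whole group of the squares, by
  convexity of the square; the latter is the value of the state \<open>\<omega> \<circ> fejer_op F\<close>.
\<close>

lemma state_seminorm_fejer_op_le:
  assumes "weyl_state s \<omega>" "finite F" "F \<noteq> {}"
  shows "state_seminorm s \<omega> (fejer_op F A) \<le> state_seminorm s (\<lambda>A. \<omega> (fejer_op F A)) A"
proof -
  \<comment> \<open>F is joined to the relevant shifts so that the sum over F is part of the sum
    over \<open>?Z\<close>.\<close>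
  let ?Z = "F \<union> (\<lambda>(x, f). x - f) ` (F \<times> Poly_Mapping.keys A)"
  let ?A = "\<lambda>z. weyl_multiplier (translate_indicator F z) A"
  let ?p = "\<lambda>z. state_seminorm s \<omega> (?A z)"
  have fin: "finite ?Z" and n: "0 < card F"
    using assms(2,3) by (auto simp: card_gt_0_iff)
  have "state_seminorm s \<omega> (fejer_op F A) \<le> (\<Sum>z\<in>F. ?p z) / card F"
    using state_seminorm_sum[OF assms(1), of ?A F] n
    by (simp add: fejer_op_eq_average[OF assms(2)] state_seminorm_scale[OF assms(1)]
      norm_inverse norm_divide field_simps)
  then have "(state_seminorm s \<omega> (fejer_op F A))\<^sup>2 \<le> ((\<Sum>z\<in>F. ?p z) / card F)\<^sup>2"
    by (intro power_mono) (simp_all add: state_seminorm_nonneg[OF assms(1)])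
  \<comment> \<open>Cauchy-Schwarz for a sum of card F terms.\<close>
  also have "\<dots> \<le> (\<Sum>z\<in>F. (?p z)\<^sup>2) / card F"
    using sum_squared_le_sum_of_squares[of ?p F] n
    by (simp add: power_divide power2_eq_square[of "real (card F)"] field_simps)
  also have "\<dots> \<le> (\<Sum>z\<in>?Z. (?p z)\<^sup>2) / card F"
    using fin by (intro divide_right_mono sum_mono2) auto
  also have "\<dots> = Re (\<omega> (fejer_op F (weyl_mult s (weyl_star A) A)))"
  proof -
    have "\<omega> (fejer_op F (weyl_mult s (weyl_star A) A)) =
        (\<Sum>z\<in>?Z. \<omega> (weyl_mult s (weyl_star (?A z)) (?A z))) / card F"
      by (rule state_fejer_op_star_mult_self[OF assms(1) fin]) force
    then show ?thesis
      by (simp add: state_seminorm_power2[OF assms(1)])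
  qed
  finally show ?thesis
    unfolding state_seminorm_def[of s "\<lambda>A. \<omega> (fejer_op F A)"] by (rule real_le_rsqrt)
qed

text \<open>Composition with \<open>fejer_op F\<close> maps states to states, so each seminorm on
  the left is bounded by a seminorm that already takes part in the supremum on the right.\<close>

lemma (in weyl_form) weyl_norm_fejer_op_le:
  assumes "finite F" "F \<noteq> {}"
  shows "weyl_norm s (fejer_op F A) \<le> weyl_norm s A"
proof (rule weyl_norm_leI)
  fix \<omega>
  assume \<omega>: "weyl_state s \<omega>"
  show "state_seminorm s \<omega> (fejer_op F A) \<le> weyl_norm s A"
    using state_seminorm_fejer_op_le[OF \<omega> assms]
      state_seminorm_le_weyl_norm[OF weyl_state_fejer_op[OF \<omega> assms]]
    by (rule order_trans)
qed

subsection \<open>Folner sets\<close>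

text \<open>Otherwise c would grow by a factor above 1 + \<epsilon> at every step, and exponential
  growth eventually exceeds the polynomial bound.\<close>

lemma exists_small_growth:
  fixes c :: "nat \<Rightarrow> nat" and \<epsilon> :: real
  assumes "0 < \<epsilon>" "\<And>n. 0 < c n" "\<And>n. c n \<le> (n + 1) ^ d"
  shows "\<exists>n. real (c (Suc n)) \<le> (1 + \<epsilon>) * c n"
proof (rule ccontr)
  assume "\<nexists>n. real (c (Suc n)) \<le> (1 + \<epsilon>) * c n"
  then have step: "(1 + \<epsilon>) * c n \<le> c (Suc n)" for n
    by (meson linear)
  have lower: "(1 + \<epsilon>) ^ n \<le> c n" for n
  proof (induction n)
    case 0
    then show ?case using assms(2)[of 0] by simp
  next
    case (Suc n)
    then have "(1 + \<epsilon>) * (1 + \<epsilon>) ^ n \<le> (1 + \<epsilon>) * c n"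
      using assms(1) by (intro mult_left_mono) auto
    then show ?case using step[of n] by simp
  qed
  have "(\<lambda>n. real (n + 1) ^ d / (1 + \<epsilon>) ^ n) \<longlonglongrightarrow> 0"
    using assms(1) by real_asymp
  then have "\<forall>\<^sub>F n in sequentially. real (n + 1) ^ d / (1 + \<epsilon>) ^ n < 1"
    by (rule order_tendstoD) simp
  then obtain n where "real (n + 1) ^ d / (1 + \<epsilon>) ^ n < 1"
    using eventually_happens'[OF sequentially_bot] by blast
  then have "real ((n + 1) ^ d) < (1 + \<epsilon>) ^ n"
    using assms(1) by (simp add: divide_less_eq)
  also have "\<dots> \<le> real (c n)"
    by (rule lower)
  finally show False
    using assms(3)[of n] by linarith
qed

text \<open>Polynomial growth of finitely generated abelian groups gives Folner sets.\<close>

lemma exists_fejer_close: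
  fixes S :: "'e::real_vector set" and \<epsilon> :: real
  assumes "finite S" "0 < \<epsilon>"
  obtains F where "finite F" "F \<noteq> {}" "\<And>k. k \<in> S \<Longrightarrow> 1 - \<epsilon> \<le> fejer F k"
proof -
  \<comment> \<open>G n will consist of the sums of elements of S with multiplicities at most n.
    Different multiplicities may give the same sum, so counting them bounds the cardinality only
    from above, which suffices for \<open>exists_small_growth\<close>.\<close>
  define P where "P = (\<lambda>n. S \<rightarrow>\<^sub>E {..n::nat})"
  define \<sigma> where "\<sigma> = (\<lambda>c :: 'e \<Rightarrow> nat. \<Sum>k\<in>S. real (c k) *\<^sub>R k)"
  define G where "G = (\<lambda>n. \<sigma> ` P n)"
  have fin: "finite (G n)" for n
    using assms(1) by (simp add: G_def P_def finite_PiE)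
  have ne: "G n \<noteq> {}" for n
    by (simp add: G_def P_def PiE_eq_empty_iff)
  have growth: "card (G n) \<le> (n + 1) ^ card S" for n
    using card_image_le[of "P n" \<sigma>] assms(1) by (simp add: G_def P_def finite_PiE card_PiE)
  have mono: "G n \<subseteq> G (Suc n)" for n
    unfolding G_def P_def by (intro image_mono PiE_mono) auto
  have shift: "z + k \<in> G (Suc n)" if z: "z \<in> G n" and k: "k \<in> S" for z k n
  proof -
    obtain c where c: "c \<in> P n" "z = \<sigma> c"
      using z by (auto simp: G_def)
    \<comment> \<open>Adding k raises its multiplicity by one, hence leads from G n into G (n +
      1).\<close>
    have "\<sigma> (c(k := Suc (c k))) = \<sigma> c + k"
      unfolding \<sigma>_def sum.remove[OF assms(1) k] by (simp add: algebra_simps)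
    moreover have "c(k := Suc (c k)) \<in> P (Suc n)"
      using c(1) k by (fastforce simp: P_def PiE_iff extensional_def)
    ultimately show ?thesis
      using c(2) by (metis G_def image_eqI)
  qed
  obtain n where n: "real (card (G (Suc n))) \<le> (1 + \<epsilon>) * card (G n)"
    using exists_small_growth[of \<epsilon> "\<lambda>n. card (G n)" "card S"] assms(2) fin ne growth
    by (auto simp: card_gt_0_iff)
  have "1 - \<epsilon> \<le> fejer (G n) k" if k: "k \<in> S" for k
  proof -
    \<comment> \<open>The translate and G n both lie in G (n + 1). By inclusion-exclusion they share
      at least 2 |G n| - |G (n + 1)| points, which is at least (1 - \<epsilon>) |G n|.\<close>
    let ?T = "(\<lambda>z. z + k) ` G n"
    have "card ?T = card (G n)"
      by (simp add: card_image)
    moreover have "card (?T \<union> G n) \<le> card (G (Suc n))"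
      using shift[OF _ k] mono by (intro card_mono fin) auto
    moreover have "card ?T + card (G n) = card (?T \<union> G n) + card (?T \<inter> G n)"
      using fin by (intro card_Un_Int) auto
    moreover have "?T \<inter> G n = (\<lambda>z. z + k) ` {z \<in> G n. z + k \<in> G n}"
      by auto
    then have "card (?T \<inter> G n) = card {z \<in> G n. z + k \<in> G n}"
      by (simp add: card_image)
    ultimately have "2 * real (card (G n)) \<le>
        card (G (Suc n)) + real (card {z \<in> G n. z + k \<in> G n})"
      by linarith
    then have "(1 - \<epsilon>) * card (G n) \<le> card {z \<in> G n. z + k \<in> G n}"
      using n by (simp add: algebra_simps)
    moreover have "0 < card (G n)"
      using fin ne by (simp add: card_gt_0_iff)
    ultimately show ?thesis
      by (simp add: fejer_def le_divide_eq)
  qed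
  then show ?thesis
    by (rule that[OF fin ne])
qed

subsection \<open>The completion\<close>

context weyl_form
begin

lemma weyl_CauchyD:
  assumes "a \<in> weyl_Cauchy s" "0 < e"
  shows "\<exists>N. \<forall>m\<ge>N. \<forall>n\<ge>N. weyl_norm s (a m - a n) < e"
  using assms unfolding weyl_Cauchy_def by blast

lemma weyl_Cauchy_const: "(\<lambda>n. A) \<in> weyl_Cauchy s"
  by (simp add: weyl_Cauchy_def)

lemma weyl_Cauchy_add:
  assumes "a \<in> weyl_Cauchy s" "b \<in> weyl_Cauchy s"
  shows "(\<lambda>n. a n + b n) \<in> weyl_Cauchy s"
  unfolding weyl_Cauchy_def
proof (intro CollectI allI impI)
  fix e :: real
  assume "0 < e"
  then have e: "0 < e / 2" by simp
  obtain M where M: "\<And>m n. m \<ge> M \<Longrightarrow> n \<ge> M \<Longrightarrow> weyl_norm s (a m - a n) < e / 2"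
    using weyl_CauchyD[OF assms(1) e] by blast
  obtain N where N: "\<And>m n. m \<ge> N \<Longrightarrow> n \<ge> N \<Longrightarrow> weyl_norm s (b m - b n) < e / 2"
    using weyl_CauchyD[OF assms(2) e] by blast
  have "weyl_norm s (a m + b m - (a n + b n)) < e" if "m \<ge> max M N" "n \<ge> max M N" for m n
  proof -
    have "weyl_norm s (a m + b m - (a n + b n)) \<le> weyl_norm s (a m - a n) + weyl_norm s (b m - b n)"
      using weyl_norm_triangle[of "a m - a n" "b m - b n"] by (simp add: algebra_simps)
    then show ?thesis
      using M[of m n] N[of m n] that by simp
  qed
  then show "\<exists>N. \<forall>m\<ge>N. \<forall>n\<ge>N. weyl_norm s (a m + b m - (a n + b n)) < e"
    by blast
qed

lemma weyl_scale_diff: "weyl_scale c (A - B) = weyl_scale c A - weyl_scale c B"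
  by (rule poly_mapping_eqI) (simp add: lookup_minus algebra_simps)

lemma weyl_Cauchy_scale:
  assumes "a \<in> weyl_Cauchy s"
  shows "(\<lambda>n. weyl_scale c (a n)) \<in> weyl_Cauchy s"
  unfolding weyl_Cauchy_def
proof (intro CollectI allI impI)
  fix e :: real
  assume e: "0 < e"
  have c: "0 < cmod c + 1"
    using norm_ge_zero[of c] by linarith
  obtain N where N: "\<And>m n. m \<ge> N \<Longrightarrow> n \<ge> N \<Longrightarrow> weyl_norm s (a m - a n) < e / (cmod c + 1)"
    using weyl_CauchyD[OF assms divide_pos_pos[OF e c]] by blast
  have "weyl_norm s (weyl_scale c (a m) - weyl_scale c (a n)) < e" if "m \<ge> N" "n \<ge> N" for m n
  proof -
    have "weyl_norm s (weyl_scale c (a m) - weyl_scale c (a n)) \<le> cmod c * weyl_norm s (a m - a n)"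
      using weyl_norm_scale_le[of c "a m - a n"] by (simp add: weyl_scale_diff)
    also have "\<dots> \<le> (cmod c + 1) * weyl_norm s (a m - a n)"
      by (intro mult_right_mono weyl_norm_nonneg) simp
    also have "\<dots> < e"
      using N[OF that] c by (simp add: less_divide_eq mult.commute)
    finally show ?thesis .
  qed
  then show "\<exists>N. \<forall>m\<ge>N. \<forall>n\<ge>N. weyl_norm s (weyl_scale c (a m) - weyl_scale c (a n)) < e"
    by blast
qed

lemma weyl_norm_tendsto_0_le:
  assumes "f \<longlonglongrightarrow> 0" "\<And>n. weyl_norm s (a n) \<le> f n"
  shows "(\<lambda>n. weyl_norm s (a n)) \<longlonglongrightarrow> 0"
  by (rule tendsto_sandwich[OF _ _ tendsto_const assms(1)])
    (simp_all add: weyl_norm_nonneg assms(2))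

lemma equiv_weyl_rel: "equiv (weyl_Cauchy s) (weyl_rel s)"
proof (rule equivI)
  show "weyl_rel s \<subseteq> weyl_Cauchy s \<times> weyl_Cauchy s"
    by (auto simp: weyl_rel_def)
  show "refl_on (weyl_Cauchy s) (weyl_rel s)"
    by (auto simp: refl_on_def weyl_rel_def)
  show "sym (weyl_rel s)"
    by (auto simp: sym_def weyl_rel_def weyl_norm_minus_commute)
  show "trans (weyl_rel s)"
    unfolding trans_def weyl_rel_def
  proof clarsimp
    fix a b c
    assume "(\<lambda>n. weyl_norm s (a n - b n)) \<longlonglongrightarrow> 0" "(\<lambda>n. weyl_norm s (b n - c n)) \<longlonglongrightarrow> 0"
    from tendsto_add[OF this] show "(\<lambda>n. weyl_norm s (a n - c n)) \<longlonglongrightarrow> 0"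
      by (intro weyl_norm_tendsto_0_le[OF _ weyl_norm_triangle_diff]) simp
  qed
qed

lemma weyl_class_eq_iff:
  assumes "a \<in> weyl_Cauchy s" "b \<in> weyl_Cauchy s"
  shows "weyl_class s a = weyl_class s b \<longleftrightarrow> (\<lambda>n. weyl_norm s (a n - b n)) \<longlonglongrightarrow> 0"
  using eq_equiv_class_iff[OF equiv_weyl_rel assms] assms
  by (simp add: weyl_class_def weyl_rel_def)

lemma mem_weyl_class_iff:
  assumes "a \<in> weyl_Cauchy s"
  shows "b \<in> weyl_class s a \<longleftrightarrow> b \<in> weyl_Cauchy s \<and> (\<lambda>n. weyl_norm s (a n - b n)) \<longlonglongrightarrow> 0"
  using assms by (simp add: weyl_class_def weyl_rel_def)

lemma weyl_class_self: "a \<in> weyl_Cauchy s \<Longrightarrow> a \<in> weyl_class s a"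
  by (simp add: mem_weyl_class_iff)

lemma carrier_weyl_algebra: "carrier (weyl_algebra s) = weyl_class s ` weyl_Cauchy s"
  by (auto simp: weyl_algebra_def quotient_def weyl_class_def)

lemma weyl_class_in_carrier: "a \<in> weyl_Cauchy s \<Longrightarrow> weyl_class s a \<in> carrier (weyl_algebra s)"
  by (simp add: carrier_weyl_algebra)

text \<open>The operation is a union over all representatives. All of them produce the same class,
  so the union is of a constant family over nonempty index sets.\<close>

lemma add_weyl_class:
  assumes a: "a \<in> weyl_Cauchy s" and b: "b \<in> weyl_Cauchy s"
  shows "weyl_class s a \<oplus>\<^bsub>weyl_algebra s\<^esub> weyl_class s b = weyl_class s (\<lambda>n. a n + b n)"
proof -
  have "weyl_class s (\<lambda>n. a' n + b' n) = weyl_class s (\<lambda>n. a n + b n)"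
    if "a' \<in> weyl_class s a" "b' \<in> weyl_class s b" for a' b'
  proof -
    have a': "a' \<in> weyl_Cauchy s" "(\<lambda>n. weyl_norm s (a n - a' n)) \<longlonglongrightarrow> 0"
      and b': "b' \<in> weyl_Cauchy s" "(\<lambda>n. weyl_norm s (b n - b' n)) \<longlonglongrightarrow> 0"
      using that a b by (simp_all add: mem_weyl_class_iff)
    have "(\<lambda>n. weyl_norm s (a n + b n - (a' n + b' n))) \<longlonglongrightarrow> 0"
    proof (rule weyl_norm_tendsto_0_le)
      show "(\<lambda>n. weyl_norm s (a n - a' n) + weyl_norm s (b n - b' n)) \<longlonglongrightarrow> 0"
        using tendsto_add[OF a'(2) b'(2)] by simp
      show "weyl_norm s (a n + b n - (a' n + b' n)) \<le>
          weyl_norm s (a n - a' n) + weyl_norm s (b n - b' n)" for n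
        using weyl_norm_triangle[of "a n - a' n" "b n - b' n"] by (simp add: algebra_simps)
    qed
    then show ?thesis
      by (subst eq_commute)
        (simp add: weyl_class_eq_iff weyl_Cauchy_add a b a'(1) b'(1))
  qed
  then have "weyl_class s a \<oplus>\<^bsub>weyl_algebra s\<^esub> weyl_class s b =
      (\<Union>a'\<in>weyl_class s a. \<Union>b'\<in>weyl_class s b. weyl_class s (\<lambda>n. a n + b n))"
    by (simp add: weyl_algebra_def)
  then show ?thesis
    using weyl_class_self[OF a] weyl_class_self[OF b] by (simp add: ex_in_conv[symmetric]) blast
qed

lemma smult_weyl_class:
  assumes a: "a \<in> weyl_Cauchy s"
  shows "c \<odot>\<^bsub>weyl_algebra s\<^esub> weyl_class s a = weyl_class s (\<lambda>n. weyl_scale c (a n))"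
proof -
  have "weyl_class s (\<lambda>n. weyl_scale c (a' n)) = weyl_class s (\<lambda>n. weyl_scale c (a n))"
    if "a' \<in> weyl_class s a" for a'
  proof -
    have a': "a' \<in> weyl_Cauchy s" "(\<lambda>n. weyl_norm s (a n - a' n)) \<longlonglongrightarrow> 0"
      using that a by (simp_all add: mem_weyl_class_iff)
    have "(\<lambda>n. weyl_norm s (weyl_scale c (a n) - weyl_scale c (a' n))) \<longlonglongrightarrow> 0"
    proof (rule weyl_norm_tendsto_0_le)
      show "(\<lambda>n. cmod c * weyl_norm s (a n - a' n)) \<longlonglongrightarrow> 0"
        using tendsto_mult_left[OF a'(2)] by simp
      show "weyl_norm s (weyl_scale c (a n) - weyl_scale c (a' n)) \<le>
          cmod c * weyl_norm s (a n - a' n)" for n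
        using weyl_norm_scale_le[of c "a n - a' n"] by (simp add: weyl_scale_diff)
    qed
    then show ?thesis
      by (subst eq_commute) (simp add: weyl_class_eq_iff weyl_Cauchy_scale a a'(1))
  qed
  then have "c \<odot>\<^bsub>weyl_algebra s\<^esub> weyl_class s a =
      (\<Union>a'\<in>weyl_class s a. weyl_class s (\<lambda>n. weyl_scale c (a n)))"
    by (simp add: weyl_algebra_def)
  then show ?thesis
    using weyl_class_self[OF a] by (simp add: ex_in_conv[symmetric]) blast
qed

lemma weyl_norm_diff_le: "\<bar>weyl_norm s A - weyl_norm s B\<bar> \<le> weyl_norm s (A - B)"
  using weyl_norm_triangle[of "A - B" B] weyl_norm_triangle[of "B - A" A]
  by (simp add: weyl_norm_minus_commute[of B A])

text \<open>This justifies the definite description in \<open>cnorm\<close>: the norms along a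
  representative form a Cauchy sequence, and equivalent representatives share the limit.\<close>

lemma tendsto_cnorm_weyl_class:
  assumes a: "a \<in> weyl_Cauchy s"
  shows "(\<lambda>n. weyl_norm s (a n)) \<longlonglongrightarrow> cnorm (weyl_algebra s) (weyl_class s a)"
proof -
  have "Cauchy (\<lambda>n. weyl_norm s (a n))"
  proof (rule metric_CauchyI)
    fix e :: real
    assume "0 < e"
    then obtain N where "\<And>m n. m \<ge> N \<Longrightarrow> n \<ge> N \<Longrightarrow> weyl_norm s (a m - a n) < e"
      using weyl_CauchyD[OF a] by blast
    then show "\<exists>M. \<forall>m\<ge>M. \<forall>n\<ge>M. dist (weyl_norm s (a m)) (weyl_norm s (a n)) < e"
      unfolding dist_real_def by (meson weyl_norm_diff_le order_le_less_trans)
  qed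
  then obtain r where r: "(\<lambda>n. weyl_norm s (a n)) \<longlonglongrightarrow> r"
    using Cauchy_convergent convergentD by blast
  have all: "(\<lambda>n. weyl_norm s (b n)) \<longlonglongrightarrow> r" if "b \<in> weyl_class s a" for b
  proof -
    have "(\<lambda>n. weyl_norm s (a n - b n)) \<longlonglongrightarrow> 0"
      using that a by (simp add: mem_weyl_class_iff)
    then have "(\<lambda>n. weyl_norm s (b n) - weyl_norm s (a n)) \<longlonglongrightarrow> 0"
      by (rule Lim_null_comparison[rotated])
        (simp add: order_trans[OF weyl_norm_diff_le] weyl_norm_minus_commute[of "b _"])
    from tendsto_add[OF this r] show ?thesis by simp
  qed
  have "cnorm (weyl_algebra s) (weyl_class s a) = r"
    unfolding weyl_algebra_def normed_star_algebra.simps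
    by (rule the_equality) (use all LIMSEQ_unique weyl_class_self[OF a] in blast)+
  with r show ?thesis by simp
qed

lemma tendsto_norm_dist_weyl_class:
  assumes "a \<in> weyl_Cauchy s" "b \<in> weyl_Cauchy s"
  shows "(\<lambda>n. weyl_norm s (a n - b n)) \<longlonglongrightarrow>
    norm_dist (weyl_algebra s) (weyl_class s a) (weyl_class s b)"
proof -
  have "A + weyl_scale (- 1) B = A - B" for A B :: "'e \<Rightarrow>\<^sub>0 complex"
    by (rule poly_mapping_eqI) (simp add: lookup_add lookup_minus)
  then show ?thesis
    using tendsto_cnorm_weyl_class[OF weyl_Cauchy_add[OF assms(1) weyl_Cauchy_scale[OF assms(2), of "- 1"]]]
    by (simp only: norm_dist_def smult_weyl_class[OF assms(2)]
      add_weyl_class[OF assms(1) weyl_Cauchy_scale[OF assms(2)]])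
qed

text \<open>Density of \<Delta>(E, s) in its completion, in the form needed to extend identities by
  continuity.\<close>

lemma norm_dist_const_tendsto_0:
  assumes a: "a \<in> weyl_Cauchy s"
  shows "(\<lambda>m. norm_dist (weyl_algebra s) (weyl_class s (\<lambda>n. a m)) (weyl_class s a)) \<longlonglongrightarrow> 0"
proof (rule metric_LIMSEQ_I)
  fix e :: real
  assume "0 < e"
  \<comment> \<open>Passing to the limit keeps only a weak inequality; halving e makes the final one
    strict.\<close>
  then have "0 < e / 2" by simp
  then obtain N where N: "\<And>m n. m \<ge> N \<Longrightarrow> n \<ge> N \<Longrightarrow> weyl_norm s (a m - a n) < e / 2"
    using weyl_CauchyD[OF a] by blast
  have "dist (norm_dist (weyl_algebra s) (weyl_class s (\<lambda>n. a m)) (weyl_class s a)) 0 < e"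
    if m: "m \<ge> N" for m
  proof -
    note lim = tendsto_norm_dist_weyl_class[OF weyl_Cauchy_const[of "a m"] a]
    have "norm_dist (weyl_algebra s) (weyl_class s (\<lambda>n. a m)) (weyl_class s a) \<le> e / 2"
      by (rule LIMSEQ_le_const2[OF lim]) (use N[OF m] less_imp_le in blast)
    moreover have "0 \<le> norm_dist (weyl_algebra s) (weyl_class s (\<lambda>n. a m)) (weyl_class s a)"
      by (rule LIMSEQ_le_const[OF lim]) (use weyl_norm_nonneg in blast)
    ultimately show ?thesis
      using \<open>0 < e\<close> by (simp add: dist_real_def)
  qed
  then show "\<exists>no. \<forall>m\<ge>no. dist (norm_dist (weyl_algebra s) (weyl_class s (\<lambda>n. a m)) (weyl_class s a)) 0 < e"
    by blast
qed

end

subsection \<open>Fourier coefficients\<close>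

text \<open>The description quantifies over all representatives and does not involve the form, so
  coefficients in W(E, 0) and W(E, h \<sigma>) can be compared directly.\<close>

definition weyl_coeff :: "(nat \<Rightarrow> ('e::real_vector \<Rightarrow>\<^sub>0 complex)) set \<Rightarrow> 'e \<Rightarrow> complex" where
  "weyl_coeff X g = (THE l. \<forall>a\<in>X. (\<lambda>n. Poly_Mapping.lookup (a n) g) \<longlonglongrightarrow> l)"

context weyl_form
begin

lemma tendsto_weyl_coeff:
  assumes a: "a \<in> weyl_Cauchy s"
  shows "(\<lambda>n. Poly_Mapping.lookup (a n) g) \<longlonglongrightarrow> weyl_coeff (weyl_class s a) g"
proof -
  have diff: "cmod (Poly_Mapping.lookup A g - Poly_Mapping.lookup B g) \<le> weyl_norm s (A - B)" for A B
    using cmod_lookup_le_weyl_norm[of "A - B" g] by (simp add: lookup_minus)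
  have "Cauchy (\<lambda>n. Poly_Mapping.lookup (a n) g)"
  proof (rule metric_CauchyI)
    fix e :: real
    assume "0 < e"
    then obtain N where "\<And>m n. m \<ge> N \<Longrightarrow> n \<ge> N \<Longrightarrow> weyl_norm s (a m - a n) < e"
      using weyl_CauchyD[OF a] by blast
    then show "\<exists>M. \<forall>m\<ge>M. \<forall>n\<ge>M. dist (Poly_Mapping.lookup (a m) g) (Poly_Mapping.lookup (a n) g) < e"
      unfolding dist_norm by (meson diff order_le_less_trans)
  qed
  then obtain l where l: "(\<lambda>n. Poly_Mapping.lookup (a n) g) \<longlonglongrightarrow> l"
    using Cauchy_convergent convergentD by blast
  have all: "(\<lambda>n. Poly_Mapping.lookup (b n) g) \<longlonglongrightarrow> l" if "b \<in> weyl_class s a" for b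
  proof -
    have "(\<lambda>n. weyl_norm s (b n - a n)) \<longlonglongrightarrow> 0"
      using that a by (simp add: mem_weyl_class_iff weyl_norm_minus_commute)
    then have "(\<lambda>n. Poly_Mapping.lookup (b n) g - Poly_Mapping.lookup (a n) g) \<longlonglongrightarrow> 0"
      by (rule Lim_null_comparison[rotated]) (simp add: diff)
    from tendsto_add[OF this l] show ?thesis by simp
  qed
  have "weyl_coeff (weyl_class s a) g = l"
    unfolding weyl_coeff_def
    by (rule the_equality) (use all LIMSEQ_unique weyl_class_self[OF a] in blast)+
  with l show ?thesis by simp
qed

lemma weyl_coeff_const: "weyl_coeff (weyl_class s (\<lambda>n. A)) g = Poly_Mapping.lookup A g"
  using tendsto_weyl_coeff[OF weyl_Cauchy_const] LIMSEQ_unique tendsto_const by blast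

lemma weyl_coeff_add:
  assumes "X \<in> carrier (weyl_algebra s)" "Y \<in> carrier (weyl_algebra s)"
  shows "weyl_coeff (X \<oplus>\<^bsub>weyl_algebra s\<^esub> Y) g = weyl_coeff X g + weyl_coeff Y g"
proof -
  obtain a b where ab: "a \<in> weyl_Cauchy s" "b \<in> weyl_Cauchy s" "X = weyl_class s a" "Y = weyl_class s b"
    using assms by (auto simp: carrier_weyl_algebra)
  show ?thesis
    using LIMSEQ_unique[OF tendsto_weyl_coeff[OF weyl_Cauchy_add[OF ab(1,2)], of g, unfolded lookup_add]
        tendsto_add[OF tendsto_weyl_coeff[OF ab(1), of g] tendsto_weyl_coeff[OF ab(2), of g]]]
    by (simp add: ab add_weyl_class)
qed

lemma weyl_coeff_smult:
  assumes "X \<in> carrier (weyl_algebra s)"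
  shows "weyl_coeff (c \<odot>\<^bsub>weyl_algebra s\<^esub> X) g = c * weyl_coeff X g"
proof -
  obtain a where a: "a \<in> weyl_Cauchy s" "X = weyl_class s a"
    using assms by (auto simp: carrier_weyl_algebra)
  show ?thesis
    using LIMSEQ_unique[OF tendsto_weyl_coeff[OF weyl_Cauchy_scale[OF a(1)], of c g, unfolded lookup_weyl_scale]
        tendsto_mult_left[OF tendsto_weyl_coeff[OF a(1), of g]]]
    by (simp add: a smult_weyl_class)
qed

lemma cmod_weyl_coeff_le_cnorm:
  assumes "X \<in> carrier (weyl_algebra s)"
  shows "cmod (weyl_coeff X g) \<le> cnorm (weyl_algebra s) X"
proof -
  obtain a where a: "a \<in> weyl_Cauchy s" "X = weyl_class s a"
    using assms by (auto simp: carrier_weyl_algebra)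
  show ?thesis
    unfolding a(2)
    by (rule LIMSEQ_le[OF tendsto_norm[OF tendsto_weyl_coeff[OF a(1)]] tendsto_cnorm_weyl_class[OF a(1)]])
      (use cmod_lookup_le_weyl_norm in blast)
qed

lemma cmod_weyl_coeff_diff_le_norm_dist:
  assumes "X \<in> carrier (weyl_algebra s)" "Y \<in> carrier (weyl_algebra s)"
  shows "cmod (weyl_coeff X g - weyl_coeff Y g) \<le> norm_dist (weyl_algebra s) X Y"
proof -
  obtain a b where ab: "a \<in> weyl_Cauchy s" "b \<in> weyl_Cauchy s" "X = weyl_class s a" "Y = weyl_class s b"
    using assms by (auto simp: carrier_weyl_algebra)
  show ?thesis
    unfolding ab(3,4)
    by (rule LIMSEQ_le[OF tendsto_norm[OF tendsto_diff[OF tendsto_weyl_coeff[OF ab(1)]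
            tendsto_weyl_coeff[OF ab(2)]]] tendsto_norm_dist_weyl_class[OF ab(1,2)]])
      (metis cmod_lookup_le_weyl_norm lookup_minus)
qed

section \<open>Fejer summation and uniqueness of Fourier coefficients\<close>

lemma weyl_norm_sub_fejer_op_le:
  assumes "finite F" "0 \<le> \<delta>" "\<And>k. k \<in> Poly_Mapping.keys A \<Longrightarrow> 1 - \<delta> \<le> fejer F k"
  shows "weyl_norm s (A - fejer_op F A) \<le> \<delta> * (\<Sum>k\<in>Poly_Mapping.keys A. cmod (Poly_Mapping.lookup A k))"
proof -
  have "weyl_norm s (A - fejer_op F A) \<le>
      (\<Sum>k\<in>Poly_Mapping.keys A. cmod (Poly_Mapping.lookup (A - fejer_op F A) k))"
    by (rule weyl_norm_le_l1) (auto simp: in_keys_iff lookup_minus)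
  also have "\<dots> \<le> (\<Sum>k\<in>Poly_Mapping.keys A. \<delta> * cmod (Poly_Mapping.lookup A k))"
  proof (rule sum_mono)
    fix k
    assume k: "k \<in> Poly_Mapping.keys A"
    \<comment> \<open>On the support of A the factor 1 - \<open>fejer F k\<close> lies between 0 and
      \<delta>.\<close>
    have "Poly_Mapping.lookup (A - fejer_op F A) k =
        complex_of_real (1 - fejer F k) * Poly_Mapping.lookup A k"
      by (simp add: lookup_minus algebra_simps)
    then have "cmod (Poly_Mapping.lookup (A - fejer_op F A) k) =
        \<bar>1 - fejer F k\<bar> * cmod (Poly_Mapping.lookup A k)"
      by (simp only: norm_mult norm_of_real)
    also have "\<dots> \<le> \<delta> * cmod (Poly_Mapping.lookup A k)"
      using assms(3)[OF k] fejer_le_1[OF assms(1), of k] by (intro mult_right_mono) auto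
    finally show "cmod (Poly_Mapping.lookup (A - fejer_op F A) k) \<le> \<dots>" .
  qed
  finally show ?thesis
    by (simp add: sum_distrib_left)
qed

text \<open>All the elements \<open>fejer_op F (a n)\<close> are supported in one finite set, where
  coefficientwise convergence implies l1 convergence.\<close>

lemma weyl_norm_fejer_op_tendsto_0:
  assumes "finite F" "\<And>g. (\<lambda>n. Poly_Mapping.lookup (a n) g) \<longlonglongrightarrow> 0"
  shows "(\<lambda>n. weyl_norm s (fejer_op F (a n))) \<longlonglongrightarrow> 0"
proof (rule weyl_norm_tendsto_0_le)
  let ?S = "{k. fejer F k \<noteq> 0}"
  have "(\<lambda>n. \<Sum>k\<in>?S. cmod (complex_of_real (fejer F k) * Poly_Mapping.lookup (a n) k)) \<longlonglongrightarrow>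
      (\<Sum>k\<in>?S. cmod (complex_of_real (fejer F k) * 0))"
    by (intro tendsto_intros assms(2))
  then show "(\<lambda>n. \<Sum>k\<in>?S. cmod (Poly_Mapping.lookup (fejer_op F (a n)) k)) \<longlonglongrightarrow> 0"
    by simp
  show "weyl_norm s (fejer_op F (a n)) \<le>
      (\<Sum>k\<in>?S. cmod (Poly_Mapping.lookup (fejer_op F (a n)) k))" for n
    by (rule weyl_norm_le_l1[OF finite_fejer_support[OF assms(1)]]) (auto simp: in_keys_iff)
qed

text \<open>A three-term estimate through \<open>fejer_op F\<close>. The order of choices matters: F
  depends on \<open>a m\<close>, and n is taken large only after F is fixed; contractivity makes the
  middle term independent of F.\<close>

lemma weyl_norm_tendsto_0I:
  assumes a: "a \<in> weyl_Cauchy s" and coeff: "\<And>g. (\<lambda>n. Poly_Mapping.lookup (a n) g) \<longlonglongrightarrow> 0"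
  shows "(\<lambda>n. weyl_norm s (a n)) \<longlonglongrightarrow> 0"
proof (rule metric_LIMSEQ_I)
  fix e :: real
  assume "0 < e"
  then have e: "0 < e / 3" by simp
  obtain N where N: "\<And>m n. m \<ge> N \<Longrightarrow> n \<ge> N \<Longrightarrow> weyl_norm s (a m - a n) < e / 3"
    using weyl_CauchyD[OF a e] by blast
  have "weyl_norm s (a m) < e" if m: "m \<ge> N" for m
  proof -
    define L where "L = (\<Sum>k\<in>Poly_Mapping.keys (a m). cmod (Poly_Mapping.lookup (a m) k))"
    \<comment> \<open>L + 1 instead of L keeps the quotient meaningful when \<open>a m\<close> is
      0.\<close>
    define \<delta> where "\<delta> = e / 3 / (L + 1)"
    have L: "0 \<le> L"
      by (simp add: L_def sum_nonneg)
    then have \<delta>: "0 < \<delta>" "\<delta> * L \<le> e / 3"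
      using \<open>0 < e\<close> by (simp_all add: \<delta>_def field_simps)
    obtain F where F: "finite F" "F \<noteq> {}"
      and close: "\<And>k. k \<in> Poly_Mapping.keys (a m) \<Longrightarrow> 1 - \<delta> \<le> fejer F k"
      using exists_fejer_close[OF finite_keys \<delta>(1)] by blast
    have "weyl_norm s (a m - fejer_op F (a m)) \<le> e / 3"
      using weyl_norm_sub_fejer_op_le[OF F(1) less_imp_le[OF \<delta>(1)] close] \<delta>(2)
      unfolding L_def by (rule order_trans)
    moreover
    \<comment> \<open>n \<ge> N is kept along, so that the Cauchy estimate applies to the pair m,
      n.\<close>
    have "\<forall>\<^sub>F n in sequentially. weyl_norm s (fejer_op F (a n)) < e / 3 \<and> n \<ge> N"
      using order_tendstoD(2)[OF weyl_norm_fejer_op_tendsto_0[OF F(1) coeff] e] eventually_ge_at_top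
      by (rule eventually_conj)
    then obtain n where "weyl_norm s (fejer_op F (a n)) < e / 3" "n \<ge> N"
      using eventually_happens'[OF sequentially_bot] by blast
    moreover have "weyl_norm s (fejer_op F (a m) - fejer_op F (a n)) \<le> weyl_norm s (a m - a n)"
      using weyl_norm_fejer_op_le[OF F, of "a m - a n"] by (simp add: fejer_op_diff)
    moreover have "weyl_norm s (a m) \<le> weyl_norm s (a m - fejer_op F (a m)) +
        weyl_norm s (fejer_op F (a m) - fejer_op F (a n)) + weyl_norm s (fejer_op F (a n))"
      using weyl_norm_triangle_diff[of "a m" 0 "fejer_op F (a m)"]
        weyl_norm_triangle_diff[of "fejer_op F (a m)" 0 "fejer_op F (a n)"] by simp
    ultimately show ?thesis
      using N[OF m, of n] by linarith
  qed
  then show "\<exists>no. \<forall>n\<ge>no. dist (weyl_norm s (a n)) 0 < e"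
    by (auto simp: dist_real_def weyl_norm_nonneg)
qed

lemma weyl_coeff_inject:
  assumes "X \<in> carrier (weyl_algebra s)" "Y \<in> carrier (weyl_algebra s)"
    and "\<And>g. weyl_coeff X g = weyl_coeff Y g"
  shows "X = Y"
proof -
  obtain a b where ab: "a \<in> weyl_Cauchy s" "b \<in> weyl_Cauchy s" "X = weyl_class s a" "Y = weyl_class s b"
    using assms by (auto simp: carrier_weyl_algebra)
  have "(\<lambda>n. a n + weyl_scale (- 1) (b n)) \<in> weyl_Cauchy s"
    by (intro weyl_Cauchy_add weyl_Cauchy_scale ab)
  moreover have "a n + weyl_scale (- 1) (b n) = a n - b n" for n
    by (rule poly_mapping_eqI) (simp add: lookup_add lookup_minus)
  ultimately have "(\<lambda>n. a n - b n) \<in> weyl_Cauchy s"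
    by simp
  moreover have "(\<lambda>n. Poly_Mapping.lookup (a n - b n) g) \<longlonglongrightarrow> 0" for g
    using tendsto_diff[OF tendsto_weyl_coeff[OF ab(1), of g] tendsto_weyl_coeff[OF ab(2), of g]]
      assms(3)[of g] by (simp add: ab lookup_minus)
  ultimately have "(\<lambda>n. weyl_norm s (a n - b n)) \<longlonglongrightarrow> 0"
    by (rule weyl_norm_tendsto_0I)
  then show ?thesis
    by (simp add: ab weyl_class_eq_iff)
qed

lemma exists_dyadic_coeffs:
  fixes f :: 'e
  assumes "f \<noteq> 0"
  obtains Y where "Y \<in> carrier (weyl_algebra s)"
    and "\<And>k::nat. weyl_coeff Y (real k *\<^sub>R f) = (1 / 2) ^ k"
proof -
  define b where "b = (\<lambda>n. \<Sum>k<n. weyl_scale ((1 / 2) ^ k) (weyl_W (real k *\<^sub>R f)))"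
  \<comment> \<open>The geometric tail is written as a difference of two tails, so that the
    induction step adds exactly (1/2)^m.\<close>
  have step: "weyl_norm s (b m - b n) \<le> 2 * (1 / 2) ^ n - 2 * (1 / 2) ^ m" if "n \<le> m" for m n
    using that
  proof (induction m rule: dec_induct)
    case (step m)
    have "weyl_norm s (weyl_scale ((1 / 2) ^ m) (weyl_W (real m *\<^sub>R f))) \<le> (1 / 2) ^ m"
      using weyl_norm_le_l1[of "{real m *\<^sub>R f}" "weyl_scale ((1 / 2) ^ m) (weyl_W (real m *\<^sub>R f))"]
      by (simp add: weyl_W_def weyl_scale_single norm_power norm_divide)
    then show ?case
      using weyl_norm_triangle[of "b m - b n" "weyl_scale ((1 / 2) ^ m) (weyl_W (real m *\<^sub>R f))"] step.IH
      by (simp add: b_def algebra_simps)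
  qed simp
  have "b \<in> weyl_Cauchy s"
    unfolding weyl_Cauchy_def
  proof (intro CollectI allI impI)
    fix e :: real
    assume e: "0 < e"
    obtain N :: nat where N: "(1 / 2) ^ N < e / 2"
      using real_arch_pow_inv[of "e / 2" "1 / 2"] e by auto
    have le: "weyl_norm s (b m - b n) < e" if "N \<le> n" "n \<le> m" for m n
    proof -
      have "(1 / 2 :: real) ^ n \<le> (1 / 2) ^ N"
        using that(1) by (intro power_decreasing) auto
      moreover have "0 < (1 / 2 :: real) ^ m"
        by simp
      ultimately show ?thesis
        using step[OF that(2)] N by linarith
    qed
    have "weyl_norm s (b m - b n) < e" if "N \<le> m" "N \<le> n" for m n
      using le[of n m] le[of m n] that weyl_norm_minus_commute[of "b m" "b n"] by (cases "n \<le> m") auto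
    then show "\<exists>N. \<forall>m\<ge>N. \<forall>n\<ge>N. weyl_norm s (b m - b n) < e"
      by blast
  qed
  moreover have "weyl_coeff (weyl_class s b) (real k *\<^sub>R f) = (1 / 2) ^ k" for k
  proof -
    \<comment> \<open>The partial sum stops before n, so the k-th term is present from n = k + 1 on.
      The points k f are distinct because f is nonzero, so no other term contributes.\<close>
    have "Poly_Mapping.lookup (b n) (real k *\<^sub>R f) = (1 / 2) ^ k" if "Suc k \<le> n" for n
    proof -
      have "Poly_Mapping.lookup (b n) (real k *\<^sub>R f) = (\<Sum>j<n. if j = k then (1 / 2) ^ j else 0)"
        unfolding b_def lookup_sum using assms
        by (intro sum.cong refl) (auto simp: weyl_W_def lookup_single when_def)
      then show ?thesis
        using that by simp
    qed
    then have "(\<lambda>n. Poly_Mapping.lookup (b n) (real k *\<^sub>R f)) \<longlonglongrightarrow> (1 / 2) ^ k"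
      by (intro tendsto_eventually eventually_sequentiallyI)
    then show ?thesis
      using tendsto_weyl_coeff[OF \<open>b \<in> weyl_Cauchy s\<close>] LIMSEQ_unique by blast
  qed
  ultimately show ?thesis
    using that[OF weyl_class_in_carrier] by blast
qed

end

subsection \<open>The quantization map\<close>

text \<open>Both sides are linear and continuous in X. They agree on the generators, hence on
  \<Delta>(E, s), and by density everywhere.\<close>

lemma weyl_coeff_linear_map:
  fixes s t :: "'e::real_vector \<Rightarrow> 'e \<Rightarrow> real"
  assumes s: "weyl_form s" and t: "weyl_form t"
    and lin: "linear_map (weyl_algebra s) (weyl_algebra t) T"
    and cont: "norm_continuous (weyl_algebra s) (weyl_algebra t) T"
    and gen: "\<And>f. T (weyl_gen s f) = c f \<odot>\<^bsub>weyl_algebra t\<^esub> weyl_gen t f"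
    and X: "X \<in> carrier (weyl_algebra s)"
  shows "weyl_coeff (T X) g = c g * weyl_coeff X g"
proof -
  interpret s: weyl_form s by (rule s)
  interpret t: weyl_form t by (rule t)
  have T_add: "T (x \<oplus>\<^bsub>weyl_algebra s\<^esub> y) = T x \<oplus>\<^bsub>weyl_algebra t\<^esub> T y"
    if "x \<in> carrier (weyl_algebra s)" "y \<in> carrier (weyl_algebra s)" for x y
    using lin that by (auto simp: linear_map_def)
  have T_smult: "T (k \<odot>\<^bsub>weyl_algebra s\<^esub> x) = k \<odot>\<^bsub>weyl_algebra t\<^esub> T x"
    and T_carrier: "T x \<in> carrier (weyl_algebra t)"
    if "x \<in> carrier (weyl_algebra s)" for x k
    using lin that by (auto simp: linear_map_def)
  let ?\<iota> = "\<lambda>A. weyl_class s (\<lambda>n. A)"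
  define L where "L = (\<lambda>A. weyl_coeff (T (?\<iota> A)) g)"
  have in_carrier: "?\<iota> A \<in> carrier (weyl_algebra s)" for A
    by (intro s.weyl_class_in_carrier s.weyl_Cauchy_const)
  have L_add: "L (A + B) = L A + L B" for A B
    using t.weyl_coeff_add[OF T_carrier T_carrier, OF in_carrier in_carrier, of A B g]
      T_add[OF in_carrier in_carrier, of A B]
      s.add_weyl_class[OF s.weyl_Cauchy_const s.weyl_Cauchy_const, of A B]
    by (simp add: L_def)
  have L_scale: "L (weyl_scale k A) = k * L A" for k A
    using t.weyl_coeff_smult[OF T_carrier, OF in_carrier, of k A g] T_smult[OF in_carrier, of k A]
      s.smult_weyl_class[OF s.weyl_Cauchy_const, of k A]
    by (simp add: L_def)
  have L_W: "L (weyl_W f) = c f * Poly_Mapping.lookup (weyl_W f) g" for f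
    using t.weyl_coeff_smult[OF t.weyl_class_in_carrier[OF t.weyl_Cauchy_const]]
    by (simp add: L_def gen[unfolded weyl_gen_def] t.weyl_coeff_const)
  have L_zero: "L 0 = 0"
    using L_add[of 0 0] by simp
  have L_sum: "L (sum A I) = (\<Sum>i\<in>I. L (A i))" for A and I :: "'e set"
    by (induction I rule: infinite_finite_induct) (simp_all add: L_zero L_add)
  have L: "L A = c g * Poly_Mapping.lookup A g" for A
  proof -
    have "L A = (\<Sum>f\<in>Poly_Mapping.keys A. Poly_Mapping.lookup A f * L (weyl_W f))"
      by (subst poly_mapping_eq_sum_W[OF finite_keys order_refl]) (simp only: L_sum L_scale)
    also have "\<dots> = (\<Sum>f\<in>Poly_Mapping.keys A. if f = g then c f * Poly_Mapping.lookup A f else 0)"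
      by (intro sum.cong refl) (simp add: L_W, simp add: weyl_W_def lookup_single when_def)
    also have "\<dots> = c g * Poly_Mapping.lookup A g"
      by (simp add: in_keys_iff)
    finally show ?thesis .
  qed
  obtain a where a: "a \<in> weyl_Cauchy s" "X = weyl_class s a"
    using X by (auto simp: s.carrier_weyl_algebra)
  \<comment> \<open>Continuity of T at X carries the approximation of X by the elements
    \<open>a m\<close> over to the target algebra.\<close>
  have "(\<lambda>m. norm_dist (weyl_algebra t) (T (?\<iota> (a m))) (T X)) \<longlonglongrightarrow> 0"
  proof (rule metric_LIMSEQ_I)
    fix e :: real
    assume "0 < e"
    then obtain d where d: "0 < d" and close: "\<And>y. y \<in> carrier (weyl_algebra s) \<Longrightarrow>
        norm_dist (weyl_algebra s) y X < d \<Longrightarrow> norm_dist (weyl_algebra t) (T y) (T X) < e"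
      using cont X unfolding norm_continuous_def by meson
    have "\<forall>\<^sub>F m in sequentially. norm_dist (weyl_algebra s) (?\<iota> (a m)) X < d"
      using order_tendstoD(2)[OF s.norm_dist_const_tendsto_0[OF a(1)] d] a(2) by simp
    then obtain N where "\<And>m. m \<ge> N \<Longrightarrow> norm_dist (weyl_algebra s) (?\<iota> (a m)) X < d"
      by (auto simp: eventually_sequentially)
    then have "norm_dist (weyl_algebra t) (T (?\<iota> (a m))) (T X) < e" if "m \<ge> N" for m
      using that close in_carrier by blast
    moreover have "0 \<le> norm_dist (weyl_algebra t) (T (?\<iota> (a m))) (T X)" for m
      using t.cmod_weyl_coeff_diff_le_norm_dist[OF T_carrier[OF in_carrier] T_carrier[OF X]]
        norm_ge_zero order_trans by blast
    ultimately show "\<exists>N. \<forall>m\<ge>N. dist (norm_dist (weyl_algebra t) (T (?\<iota> (a m))) (T X)) 0 < e"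
      by (auto simp: dist_real_def)
  qed
  then have "(\<lambda>m. L (a m) - weyl_coeff (T X) g) \<longlonglongrightarrow> 0"
    by (rule Lim_null_comparison[rotated])
      (simp add: L_def t.cmod_weyl_coeff_diff_le_norm_dist T_carrier[OF in_carrier] T_carrier[OF X])
  from tendsto_add[OF this tendsto_const[of "weyl_coeff (T X) g"]]
  have "(\<lambda>m. L (a m)) \<longlonglongrightarrow> weyl_coeff (T X) g"
    by simp
  moreover have "(\<lambda>m. L (a m)) \<longlonglongrightarrow> c g * weyl_coeff X g"
    unfolding L a(2) by (intro tendsto_mult_left s.tendsto_weyl_coeff a(1))
  ultimately show ?thesis
    by (rule LIMSEQ_unique)
qed

text \<open>Hermitian symmetry makes the inner product of f with itself real, so its imaginary part
  vanishes.\<close>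

lemma weyl_form_symp: "weyl_form (\<lambda>f g. h * symp f g)"
proof
  fix f :: 'a
  have "cinner f (- f) = - cinner f f"
    using cinner_add_right[of f f "- f"] cinner_add_right[of f 0 0]
    by (simp add: eq_neg_iff_add_eq_0 add.commute)
  then have "cinner (- f) f = - cinner f f"
    using cinner_commute[of "- f" f] cinner_commute[of f f] by simp
  moreover have "Im (cinner f f) = 0"
    using cinner_commute[of f f] by (simp add: complex_eq_iff)
  ultimately show "h * symp (- f) f = 0"
    by (simp add: symp_def)
qed

text \<open>For h = 0 the map is the identity, and for E = {0} both algebras are one-dimensional.
  Nonsurjectivity is therefore stated for h > 0 and nonzero E.\<close>

theorem proposition3p7:
  fixes h :: real
    and Q :: "(nat \<Rightarrow> ('h::complex_hilbert_space \<Rightarrow>\<^sub>0 complex)) set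
               \<Rightarrow> (nat \<Rightarrow> ('h \<Rightarrow>\<^sub>0 complex)) set"
  assumes "separable_space (euclidean :: 'h topology)"
    and "h \<ge> 0"
    and "is_quantization_map h Q"
  shows "inj_on Q (carrier (Weyl 0)) \<and>
         (h > 0 \<and> (\<exists>f::'h. f \<noteq> 0) \<longrightarrow> Q ` carrier (Weyl 0) \<noteq> carrier (Weyl h))"
proof -
  \<comment> \<open>The zero form is written as a product to match the unfolding of
    \<open>Weyl 0\<close> literally.\<close>
  interpret cl: weyl_form "\<lambda>f g :: 'h. 0 * symp f g" by (rule weyl_form_symp)
  interpret qu: weyl_form "\<lambda>f g :: 'h. h * symp f g" by (rule weyl_form_symp)
  have coeff: "weyl_coeff (Q X) g =
      complex_of_real (exp (- (h / 4) * (norm g)\<^sup>2)) * weyl_coeff X g"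
    if "X \<in> carrier (Weyl 0)" for X g
    using weyl_coeff_linear_map[OF cl.weyl_form_axioms qu.weyl_form_axioms, of Q
        "\<lambda>g. complex_of_real (exp (- (h / 4) * (norm g)\<^sup>2))" X g] assms(3) that
    unfolding is_quantization_map_def Weyl_def Weyl_gen_def by blast
  have "inj_on Q (carrier (Weyl 0))"
  proof (rule inj_onI)
    fix X Y
    assume XY: "X \<in> carrier (Weyl 0)" "Y \<in> carrier (Weyl 0)" "Q X = Q Y"
    \<comment> \<open>The Gaussian factor is never zero and cancels.\<close>
    have "weyl_coeff X g = weyl_coeff Y g" for g
      using coeff[OF XY(1), of g] coeff[OF XY(2), of g] XY(3) by simp
    with XY(1,2) show "X = Y"
      unfolding Weyl_def by (intro cl.weyl_coeff_inject)
  qed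
  moreover have "Q ` carrier (Weyl 0) \<noteq> carrier (Weyl h)" if h: "h > 0" and f: "f \<noteq> 0" for f :: 'h
  proof
    assume surj: "Q ` carrier (Weyl 0) = carrier (Weyl h)"
    obtain Y where Y_carrier: "Y \<in> carrier (Weyl h)"
      and Y: "\<And>k::nat. weyl_coeff Y (real k *\<^sub>R f) = (1 / 2) ^ k"
      using qu.exists_dyadic_coeffs[OF f] unfolding Weyl_def by blast
    have "Y \<in> Q ` carrier (Weyl 0)"
      unfolding surj by (rule Y_carrier)
    then obtain X where X: "X \<in> carrier (Weyl 0)" "Q X = Y"
      by (elim imageE) simp
    define c where "c = h / 4 * (norm f)\<^sup>2"
    have c: "0 < c"
      using h f by (simp add: c_def)
    \<comment> \<open>Dividing the dyadic coefficient of Y at k f by the Gaussian factor gives the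
      coefficient of X there, which the norm of X must dominate.\<close>
    have bounded: "exp (c * (real k)\<^sup>2) / 2 ^ k \<le> cnorm (Weyl 0) X" for k :: nat
    proof -
      have "complex_of_real (exp (- (c * (real k)\<^sup>2))) * weyl_coeff X (real k *\<^sub>R f) = (1 / 2) ^ k"
        using coeff[OF X(1), of "real k *\<^sub>R f"] X(2) Y[of k]
        by (simp add: c_def power_mult_distrib mult_ac)
      from arg_cong[OF this, of cmod]
      have "exp (- (c * (real k)\<^sup>2)) * cmod (weyl_coeff X (real k *\<^sub>R f)) = (1 / 2) ^ k"
        by (simp add: norm_mult norm_power norm_divide)
      moreover have "cmod (weyl_coeff X (real k *\<^sub>R f)) = exp (c * (real k)\<^sup>2) *
          (exp (- (c * (real k)\<^sup>2)) * cmod (weyl_coeff X (real k *\<^sub>R f)))"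
        by (simp add: exp_minus_inverse flip: mult.assoc)
      ultimately have "cmod (weyl_coeff X (real k *\<^sub>R f)) = exp (c * (real k)\<^sup>2) / 2 ^ k"
        by (simp add: power_one_over)
      then show ?thesis
        using cl.cmod_weyl_coeff_le_cnorm[of X "real k *\<^sub>R f"] X(1) by (simp add: Weyl_def)
    qed
    \<comment> \<open>The exponent c k^2 outgrows k ln 2.\<close>
    have "filterlim (\<lambda>k::nat. exp (c * (real k)\<^sup>2) / 2 ^ k) at_top sequentially"
      using c by real_asymp
    then have "\<forall>\<^sub>F k in sequentially. cnorm (Weyl 0) X < exp (c * (real k)\<^sup>2) / 2 ^ k"
      by (simp add: filterlim_at_top_dense)
    then show False
      using eventually_happens'[OF sequentially_bot] bounded by (meson not_le)
  qed
  ultimately show ?thesis by blast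
qed

end
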